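(* Fix an equation $(f,q,w)$ as in the context. Let $\gamma\in(-\pi,\pi]$ and $K=(k_{ij})\in SL(2,\mathbb R)$ with $k_{11}-f_0k_{12}\neq0$. If $k_{11}\neq0$ let $\widehat K=\begin{pmatrix}k_{11}&k_{11}/f_0\\k_{21}&(f_0+k_{11}k_{21})/(k_{11}f_0)\end{pmatrix}$; if $k_{12}\neq0$ let $\widetilde K=\begin{pmatrix}f_0k_{12}&k_{12}\\(f_0k_{12}k_{22}-1)/k_{12}&k_{22}\end{pmatrix}$. Write $\lambda_n(e^{i\gamma}L)$ for the eigenvalues with boundary condition $[e^{i\gamma}L|-I]$. Then the problem with $[e^{i\gamma}K|-I]$ has exactly $N$ eigenvalues and the problems with $[e^{i\gamma}\widehat K|-I]$ and $[e^{i\gamma}\widetilde K|-I]$ (when defined) have exactly $N-1$ eigenvalues. Moreover: (i) if $k_{11}\ne0$, then $\lambda_n(e^{i\gamma}K)\le\lambda_n(e^{i\gamma}\widehat K)\le\lambda_{n+1}(e^{i\gamma}K)$ for $0\le n\le N-2$; (ii) if $k_{12}\neq0$, then $\lambda_n(e^{i\gamma}K)\le\lambda_n(e^{i\gamma}\widetilde K)\le\lambda_{n+1}(e^{i\gamma}K)$ for $0\le n\le N-2$.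
   Context: Let $N\ge2$ be an integer. An equation is given by real sequences $f=\{f_n\}_{n=0}^N$, $q=\{q_n\}_{n=1}^N$, $w=\{w_n\}_{n=1}^N$ with $f_n\neq0$, $w_n>0$; it is $-\nabla(f_n\Delta y_n)+q_ny_n=\lambda w_ny_n$, $1\le n\le N$, for $y=\{y_n\}_{n=0}^{N+1}$, $\Delta y_n=y_{n+1}-y_n$, $\nabla y_n=y_n-y_{n-1}$. The boundary condition $[A\,|\,B]$ is $A(y_0,f_0\Delta y_0)^T+B(y_N,f_N\Delta y_N)^T=0$. $SL(2,\mathbb R)$: real $2\times2$ matrices of determinant 1; $I$ the identity. Eigenvalues ($\lambda$ with a nontrivial solution) are real; multiplicity = dimension of the solution space (equal to the multiplicity as a zero of the characteristic polynomial); counted with multiplicity they are ordered $\lambda_0\le\lambda_1\le\cdots$, and "exactly $k$ eigenvalues" counts multiplicity. *)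

theory Defs
  imports "HOL-Analysis.Analysis" "HOL-Library.Function_Algebras" "HOL-Library.Multiset"
begin

text \<open>Discrete Sturm-Liouville problem
  -nabla(f_n Delta y_n) + q_n y_n = lambda w_n y_n, 1 <= n <= N,
  with boundary condition [A | B]:  A (y_0, f_0 Delta y_0)^T + B (y_N, f_N Delta y_N)^T = 0.
  Sequences y = (y_0, ..., y_{N+1}) are complex valued; they are represented as
  functions nat => complex vanishing for indices > N+1.\<close>

definition sl_solution ::
  "(nat \<Rightarrow> real) \<Rightarrow> (nat \<Rightarrow> real) \<Rightarrow> (nat \<Rightarrow> real) \<Rightarrow> nat \<Rightarrow>
   complex^2^2 \<Rightarrow> complex^2^2 \<Rightarrow> complex \<Rightarrow> (nat \<Rightarrow> complex) \<Rightarrow> bool" where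
  "sl_solution f q w N A B lam y \<longleftrightarrow>
     (\<forall>n > N + 1. y n = 0) \<and>
     (\<forall>n\<in>{1..N}.
        - (of_real (f n) * (y (n+1) - y n) - of_real (f (n-1)) * (y n - y (n-1)))
        + of_real (q n) * y n = lam * of_real (w n) * y n) \<and>
     A *v vector [y 0, of_real (f 0) * (y 1 - y 0)]
       + B *v vector [y N, of_real (f N) * (y (N+1) - y N)] = 0"

definition sl_solution_space ::
  "(nat \<Rightarrow> real) \<Rightarrow> (nat \<Rightarrow> real) \<Rightarrow> (nat \<Rightarrow> real) \<Rightarrow> nat \<Rightarrow>
   complex^2^2 \<Rightarrow> complex^2^2 \<Rightarrow> complex \<Rightarrow> (nat \<Rightarrow> complex) set" where
  "sl_solution_space f q w N A B lam = {y. sl_solution f q w N A B lam y}"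

definition sl_eigenvalues ::
  "(nat \<Rightarrow> real) \<Rightarrow> (nat \<Rightarrow> real) \<Rightarrow> (nat \<Rightarrow> real) \<Rightarrow> nat \<Rightarrow>
   complex^2^2 \<Rightarrow> complex^2^2 \<Rightarrow> complex set" where
  "sl_eigenvalues f q w N A B =
     {lam. \<exists>y. sl_solution f q w N A B lam y \<and> y \<noteq> 0}"

definition sl_mult ::
  "(nat \<Rightarrow> real) \<Rightarrow> (nat \<Rightarrow> real) \<Rightarrow> (nat \<Rightarrow> real) \<Rightarrow> nat \<Rightarrow>
   complex^2^2 \<Rightarrow> complex^2^2 \<Rightarrow> complex \<Rightarrow> nat" where
  "sl_mult f q w N A B lam =
     vector_space.dim (\<lambda>(c::complex) (y::nat \<Rightarrow> complex). (\<lambda>n. c * y n))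
       (sl_solution_space f q w N A B lam)"

definition sl_eig_mset ::
  "(nat \<Rightarrow> real) \<Rightarrow> (nat \<Rightarrow> real) \<Rightarrow> (nat \<Rightarrow> real) \<Rightarrow> nat \<Rightarrow>
   complex^2^2 \<Rightarrow> complex^2^2 \<Rightarrow> complex multiset" where
  "sl_eig_mset f q w N A B =
     (\<Sum>lam\<in>sl_eigenvalues f q w N A B. replicate_mset (sl_mult f q w N A B lam) lam)"

definition sl_has_exactly ::
  "(nat \<Rightarrow> real) \<Rightarrow> (nat \<Rightarrow> real) \<Rightarrow> (nat \<Rightarrow> real) \<Rightarrow> nat \<Rightarrow>
   complex^2^2 \<Rightarrow> complex^2^2 \<Rightarrow> nat \<Rightarrow> bool" where
  "sl_has_exactly f q w N A B k \<longleftrightarrow>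
     finite (sl_eigenvalues f q w N A B) \<and> size (sl_eig_mset f q w N A B) = k"

text \<open>lambda_n: the n-th eigenvalue (0-based) in nondecreasing order, counted with
  multiplicity.  Eigenvalues are real, so we order their real parts.\<close>
definition sl_lambda ::
  "(nat \<Rightarrow> real) \<Rightarrow> (nat \<Rightarrow> real) \<Rightarrow> (nat \<Rightarrow> real) \<Rightarrow> nat \<Rightarrow>
   complex^2^2 \<Rightarrow> complex^2^2 \<Rightarrow> nat \<Rightarrow> real" where
  "sl_lambda f q w N A B n =
     sorted_list_of_multiset (image_mset Re (sl_eig_mset f q w N A B)) ! n"

definition cis_mat :: "real \<Rightarrow> real^2^2 \<Rightarrow> complex^2^2" where
  "cis_mat \<gamma> L = (\<chi> i j. cis \<gamma> * of_real (L $ i $ j))"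

definition mat22 :: "real \<Rightarrow> real \<Rightarrow> real \<Rightarrow> real \<Rightarrow> real^2^2" where
  "mat22 a b c d = vector [vector [a, b], vector [c, d]]"

definition K_hat :: "real \<Rightarrow> real^2^2 \<Rightarrow> real^2^2" where
  "K_hat f0 K = mat22 (K$1$1) (K$1$1 / f0)
                      (K$2$1) ((f0 + K$1$1 * K$2$1) / (K$1$1 * f0))"

definition K_tilde :: "real \<Rightarrow> real^2^2 \<Rightarrow> real^2^2" where
  "K_tilde f0 K = mat22 (f0 * K$1$2) (K$1$2)
                        ((f0 * K$1$2 * K$2$2 - 1) / K$1$2) (K$2$2)"

end

theory Submission
  imports Defs "HOL-Computational_Algebra.Fundamental_Theorem_Algebra"
begin

text \<open>Because \<open>k11 - f0 * k12 \<noteq> 0\<close>, the boundary condition expresses \<open>y 0\<close> and \<open>y (N+1)\<close> through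
  \<open>y 1\<close> and \<open>y N\<close>. The problem for \<open>K\<close> is thus a Hermitian eigenvalue problem on \<open>\<complex>\<^sup>N\<close>
  with respect to the weight \<open>w\<close>; symmetry is Lagrange's identity together with \<open>det K = 1\<close>.
  The matrices \<open>K_hat\<close> and \<open>K_tilde\<close> are singular in the sense that \<open>k11 = f0 * k12\<close>. They force
  \<open>y N = cis \<gamma> * k11 * y 1\<close> and leave \<open>y 0\<close> free, and eliminating \<open>y 0\<close> gives exactly the
  compression of the form of \<open>K\<close> to that hyperplane. Cauchy interlacing does the rest.\<close>

subsection \<open>Hermitian pencils\<close>


text \<open>The obstacle is that a singular boundary condition does not fix \<open>y 0\<close>, so
  its problem does not directly give an operator on the interior values. Everything is therefore
  kept in weak form: an eigenvector is a \<open>y\<close> with \<open>h x y = a * g x y\<close> for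
  all test vectors \<open>x\<close> of the subspace, and passing to the hyperplane merely restricts
  \<open>x\<close> and \<open>y\<close>. On the hyperplane the weak equation allows nonzero defects
  in the equations at 1 and \<open>N\<close>, tied by one linear relation. They are absorbed by the
  choice of \<open>y 0\<close> and \<open>y (N+1)\<close>, and the relation between them becomes the
  second boundary condition of the singular problem. Two identities make this work for every value
  of \<open>y 0\<close>: \<open>det L = 1\<close> together with \<open>L11 = f 0 * L12\<close>
  cancels the coefficient of \<open>y 0\<close>, and \<open>form_match\<close> cancels what
  remains.\<close>

text \<open>Gaussian elimination on the equations: a pivot \<open>p\<close> with
  \<open>M p j \<noteq> 0\<close> is used to clear equation \<open>j\<close> from all other unknowns
  (\<open>M'\<close>), and the coefficient of \<open>p\<close> is recovered at the end. All
  dimension counts below rest on this lemma.\<close>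

lemma underdetermined_system_nontrivial:
  fixes M :: "'i \<Rightarrow> 'j \<Rightarrow> 'k::field"
  assumes "finite J" "finite I" "card J < card I"
  shows "\<exists>c. (\<exists>i\<in>I. c i \<noteq> 0) \<and> (\<forall>j\<in>J. (\<Sum>i\<in>I. c i * M i j) = 0)"
  using assms
proof (induction J arbitrary: I M rule: finite_induct)
  case empty
  then obtain i where "i \<in> I" by fastforce
  then show ?case by (intro exI[of _ "\<lambda>_. 1"]) auto
next
  case (insert j J)
  show ?case
  proof (cases "\<forall>i\<in>I. M i j = 0")
    case True
    obtain c where "\<exists>i\<in>I. c i \<noteq> 0" "\<forall>j\<in>J. (\<Sum>i\<in>I. c i * M i j) = 0"
      using insert.IH[of I M] insert.prems insert.hyps by (metis card_insert_disjoint Suc_lessD)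
    then show ?thesis using True by (intro exI[of _ c]) auto
  next
    case False
    then obtain p where p: "p \<in> I" "M p j \<noteq> 0" by blast
    define I' where "I' = I - {p}"
    define M' where "M' = (\<lambda>i k. M i k - M i j / M p j * M p k)"
    have "card J < card I'" using insert p unfolding I'_def by simp
    then obtain c where c: "\<exists>i\<in>I'. c i \<noteq> 0" "\<forall>k\<in>J. (\<Sum>i\<in>I'. c i * M' i k) = 0"
      using insert.IH[of I' M'] insert.prems unfolding I'_def by blast
    define s where "s = (\<Sum>i\<in>I'. c i * M i j) / M p j"
    define d where "d = c(p := - s)"
    have split: "(\<Sum>i\<in>I. d i * M i k) = (\<Sum>i\<in>I'. c i * M i k) - s * M p k" for k
    proof -
      have "(\<Sum>i\<in>I. d i * M i k) = d p * M p k + (\<Sum>i\<in>I'. d i * M i k)"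
        unfolding I'_def using p insert.prems by (simp add: sum.remove)
      also have "(\<Sum>i\<in>I'. d i * M i k) = (\<Sum>i\<in>I'. c i * M i k)"
        by (intro sum.cong) (auto simp: I'_def d_def)
      finally show ?thesis by (simp add: d_def)
    qed
    have M': "(\<Sum>i\<in>I'. c i * M' i k) = (\<Sum>i\<in>I'. c i * M i k) - s * M p k" for k
      unfolding M'_def s_def
      by (simp add: right_diff_distrib sum_subtractf sum_divide_distrib sum_distrib_right mult.assoc)
    have "(\<Sum>i\<in>I. d i * M i k) = 0" if "k \<in> insert j J" for k
    proof (cases "k = j")
      case True
      then show ?thesis using p by (simp add: split s_def)
    next
      case False
      then show ?thesis using that c(2) by (simp add: split flip: M')
    qed
    moreover have "\<exists>i\<in>I. d i \<noteq> 0" using c(1) by (auto simp: d_def I'_def)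
    ultimately show ?thesis by blast
  qed
qed

text \<open>Both forms live on the whole type and only positivity refers to \<open>E\<close>, so the
  same \<open>g\<close> and \<open>h\<close> can be reused on a smaller subspace.
  \<open>finite_span\<close> is required because the sequence space to which this is applied is
  infinite-dimensional.\<close>

locale hermitian_pencil = vector_space scale
  for scale :: "complex \<Rightarrow> 'a::ab_group_add \<Rightarrow> 'a" (infixr \<open>\<cdot>\<close> 75) +
  fixes E :: "'a set" and g h :: "'a \<Rightarrow> 'a \<Rightarrow> complex"
  assumes subspace_E: "subspace E"
    and finite_span: "\<exists>B. finite B \<and> E \<subseteq> span B"
    and g_add: "g x (y + z) = g x y + g x z"
    and g_scale: "g x (c \<cdot> y) = c * g x y"
    and g_hermitian: "g x y = cnj (g y x)"
    and g_pos: "x \<in> E \<Longrightarrow> x \<noteq> 0 \<Longrightarrow> Re (g x x) > 0"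
    and h_add: "h x (y + z) = h x y + h x z"
    and h_scale: "h x (c \<cdot> y) = c * h x y"
    and h_hermitian: "h x y = cnj (h y x)"
begin

lemma g_zero: "g x 0 = 0"
  using g_scale[of x 0 0] by simp

lemma h_zero: "h x 0 = 0"
  using h_scale[of x 0 0] by simp

lemma g_diff: "g x (y - z) = g x y - g x z"
  using g_add[of x "y - z" z] by simp

lemma g_sum: "g x (\<Sum>i\<in>A. F i) = (\<Sum>i\<in>A. g x (F i))"
  by (induction A rule: infinite_finite_induct) (simp_all add: g_zero g_add)

lemma h_sum: "h x (\<Sum>i\<in>A. F i) = (\<Sum>i\<in>A. h x (F i))"
  by (induction A rule: infinite_finite_induct) (simp_all add: h_zero h_add)

lemma g_eq_0_commute: "g x y = 0 \<longleftrightarrow> g y x = 0"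
  by (subst g_hermitian) simp

lemma g_diag_real: "g x x = of_real (Re (g x x))"
  using g_hermitian[of x x] by (simp add: complex_eq_iff)

lemma h_diag_real: "h x x = of_real (Re (h x x))"
  using h_hermitian[of x x] by (simp add: complex_eq_iff)

definition orthonormal :: "'a set \<Rightarrow> bool" where
  "orthonormal S \<longleftrightarrow> finite S \<and> S \<subseteq> E \<and> (\<forall>s\<in>S. \<forall>t\<in>S. g s t = of_bool (s = t))"

lemma orthonormal_coeff:
  assumes "orthonormal S" "t \<in> S"
  shows "g t (\<Sum>s\<in>S. a s \<cdot> s) = a t"
proof -
  have "g t (\<Sum>s\<in>S. a s \<cdot> s) = (\<Sum>s\<in>S. a s * of_bool (t = s))"
    using assms by (simp add: g_sum g_scale orthonormal_def)
  also have "\<dots> = (\<Sum>s\<in>S. if t = s then a s else 0)"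
    by (intro sum.cong) auto
  also have "\<dots> = a t"
    using assms by (simp add: orthonormal_def)
  finally show ?thesis .
qed

lemma orthonormal_independent:
  assumes "orthonormal S"
  shows "independent S"
proof (rule independent_if_scalars_zero)
  show "finite S" using assms by (simp add: orthonormal_def)
  fix a t assume "(\<Sum>s\<in>S. a s \<cdot> s) = 0" "t \<in> S"
  then show "a t = 0" using orthonormal_coeff[OF assms, of t a] by (simp add: g_zero)
qed

text \<open>Orthonormal sets are no larger than a finite spanning set, so one of greatest
  cardinality exists among those with property \<open>P\<close>. If it were incomplete,
  \<open>extend\<close> would supply a vector whose normalization enlarges it. A trivial
  \<open>P\<close> gives an orthonormal basis; \<open>P\<close> = "is an eigenvector" gives the
  spectral theorem.\<close>

lemma maximal_orthonormal:
  assumes scale_P: "\<And>c z. P z \<Longrightarrow> P (c \<cdot> z)"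
    and extend: "\<And>S y. orthonormal S \<Longrightarrow> \<forall>s\<in>S. P s \<Longrightarrow> y \<in> E \<Longrightarrow> y \<noteq> 0 \<Longrightarrow> \<forall>s\<in>S. g s y = 0
      \<Longrightarrow> \<exists>z\<in>E. P z \<and> z \<noteq> 0 \<and> (\<forall>s\<in>S. g s z = 0)"
  shows "\<exists>S. orthonormal S \<and> (\<forall>s\<in>S. P s) \<and> (\<forall>y\<in>E. (\<forall>s\<in>S. g s y = 0) \<longrightarrow> y = 0)"
proof -
  obtain B where B: "finite B" "E \<subseteq> span B" using finite_span by blast
  have bound: "card S \<le> card B" if "orthonormal S" for S
    using independent_span_bound[OF B(1) orthonormal_independent[OF that]] B that
    by (auto simp: orthonormal_def)
  let ?Q = "\<lambda>S. orthonormal S \<and> (\<forall>s\<in>S. P s)"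
  have "?Q {}" by (simp add: orthonormal_def)
  then obtain S where S: "?Q S" and max: "\<And>S'. ?Q S' \<Longrightarrow> card S' \<le> card S"
    using ex_has_greatest_nat[of ?Q "{}" card "Suc (card B)"] bound by (auto simp: less_Suc_eq_le)
  have "y = 0" if y: "y \<in> E" "\<forall>s\<in>S. g s y = 0" for y
  proof (rule ccontr)
    assume "y \<noteq> 0"
    then obtain z where z: "z \<in> E" "P z" "z \<noteq> 0" "\<forall>s\<in>S. g s z = 0"
      using extend[of S y] S y by blast
    define r where "r = sqrt (Re (g z z))"
    have r: "r > 0" "g z z = of_real (r * r)"
      using g_pos[OF z(1,3)] g_diag_real[of z] by (auto simp: r_def)
    define u where "u = of_real (1 / r) \<cdot> z"
    have uz: "g x u = of_real (1 / r) * g x z" for x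
      by (simp add: u_def g_scale)
    have uu: "g u u = 1"
    proof -
      have "g u u = of_real (1/r) * cnj (g z u)" by (subst g_hermitian[of z u]) (simp add: uz)
      also have "\<dots> = 1" using r by (simp add: uz)
      finally show ?thesis .
    qed
    have us: "g s u = 0" "g u s = 0" if "s \<in> S" for s
      using z(4) that uz[of s] g_eq_0_commute[of u s] by auto
    have "u \<notin> S" using us uu by auto
    have "?Q (insert u S)"
      using S uu us z scale_P[OF z(2)] subspace_scale[OF subspace_E z(1)]
      by (auto simp: orthonormal_def u_def)
    then show False using max[of "insert u S"] \<open>u \<notin> S\<close> S by (auto simp: orthonormal_def)
  qed
  then show ?thesis using S by blast
qed

lemma complete_expansion:
  assumes S: "orthonormal S" and complete: "\<forall>y\<in>E. (\<forall>s\<in>S. g s y = 0) \<longrightarrow> y = 0" and y: "y \<in> E"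
  shows "y = (\<Sum>s\<in>S. g s y \<cdot> s)"
proof -
  let ?z = "y - (\<Sum>s\<in>S. g s y \<cdot> s)"
  have "?z \<in> E"
    using S y by (intro subspace_diff subspace_sum subspace_scale subspace_E) (auto simp: orthonormal_def)
  moreover have "g s ?z = 0" if "s \<in> S" for s
    using orthonormal_coeff[OF S that] by (simp add: g_diff)
  ultimately have "?z = 0" using complete by blast
  then show ?thesis by (rule eq_iff_diff_eq_0[THEN iffD2])
qed

lemma complete_card:
  assumes S: "orthonormal S" and complete: "\<forall>y\<in>E. (\<forall>s\<in>S. g s y = 0) \<longrightarrow> y = 0"
  shows "card S = dim E"
proof (rule basis_card_eq_dim)
  show "S \<subseteq> E" "independent S"
    using S orthonormal_independent by (auto simp: orthonormal_def)
  show "E \<subseteq> span S"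
  proof
    fix y assume "y \<in> E"
    have "(\<Sum>s\<in>S. g s y \<cdot> s) \<in> span S"
      by (intro span_sum span_scale span_base)
    with complete_expansion[OF S complete \<open>y \<in> E\<close>] show "y \<in> span S" by simp
  qed
qed

lemma orthonormal_basis_exists:
  "\<exists>S. orthonormal S \<and> (\<forall>y\<in>E. (\<forall>s\<in>S. g s y = 0) \<longrightarrow> y = 0)"
proof -
  have "\<exists>S. orthonormal S \<and> (\<forall>s\<in>S. True) \<and> (\<forall>y\<in>E. (\<forall>s\<in>S. g s y = 0) \<longrightarrow> y = 0)"
    by (rule maximal_orthonormal) auto
  then show ?thesis by simp
qed

end

text \<open>An annihilating polynomial of minimal degree at \<open>y\<close> has a root; dividing out the
  corresponding linear factor leaves an eigenvector.\<close>
lemma eigenvector_of_dependent_orbit: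
  fixes scale :: "'a::field \<Rightarrow> 'b::ab_group_add \<Rightarrow> 'b" (infixr \<open>\<cdot>\<close> 75)
    and T :: "'b \<Rightarrow> 'b" and y :: 'b
  assumes "vector_space scale"
    and alg_closed: "\<And>p :: 'a poly. degree p > 0 \<Longrightarrow> \<exists>a. poly p a = 0"
    and F: "module.subspace scale F" "\<And>x. x \<in> F \<Longrightarrow> T x \<in> F" "y \<in> F" "y \<noteq> 0"
    and T_add: "\<And>u v. T (u + v) = T u + T v"
    and T_scale: "\<And>c v. T (c \<cdot> v) = c \<cdot> T v"
    and dep: "(\<Sum>i\<le>n. c i \<cdot> (T ^^ i) y) = 0" "\<exists>i\<le>n. c i \<noteq> 0"
  shows "\<exists>z\<in>F. z \<noteq> 0 \<and> (\<exists>a. T z = a \<cdot> z)"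
proof -
  interpret vector_space scale by fact
  have T_sum: "T (\<Sum>i\<in>A. G i) = (\<Sum>i\<in>A. T (G i))" for A :: "nat set" and G
    using T_scale[of 0 0] by (induction A rule: infinite_finite_induct) (simp_all add: T_add)
  have orbit: "(T ^^ i) y \<in> F" for i
    by (induction i) (simp_all add: F)
  \<comment> \<open>\<open>ev p\<close> is p(T) applied to \<open>y\<close>.\<close>
  define ev where "ev p = (\<Sum>i\<le>degree p. coeff p i \<cdot> (T ^^ i) y)" for p
  have ev_upto: "ev p = (\<Sum>i\<le>m. coeff p i \<cdot> (T ^^ i) y)" if "degree p \<le> m" for p m
    unfolding ev_def using that
    by (intro sum.mono_neutral_left) (auto simp: coeff_eq_0)
  have ev_F: "ev p \<in> F" for p
    unfolding ev_def by (intro subspace_sum subspace_scale F orbit)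
  have ev_factor: "ev ([:-a, 1:] * r) = T (ev r) - a \<cdot> ev r" for a r
  proof -
    let ?m = "Suc (degree r)"
    have "degree ([:-a, 1:] * r) \<le> ?m"
      using degree_mult_le[of "[:-a, 1:]" r] by simp
    then have "ev ([:-a, 1:] * r) = (\<Sum>i\<le>?m. coeff (pCons 0 r - smult a r) i \<cdot> (T ^^ i) y)"
      by (subst ev_upto[of _ ?m]) (simp_all add: algebra_simps)
    also have "\<dots> = (\<Sum>i\<le>?m. coeff (pCons 0 r) i \<cdot> (T ^^ i) y) - (\<Sum>i\<le>?m. a \<cdot> coeff r i \<cdot> (T ^^ i) y)"
      by (simp only: coeff_diff coeff_smult scale_left_diff_distrib sum_subtractf scale_scale)
    also have "(\<Sum>i\<le>?m. coeff (pCons 0 r) i \<cdot> (T ^^ i) y) = T (ev r)"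
      by (subst sum.atMost_Suc_shift) (simp add: ev_def T_sum T_scale)
    also have "(\<Sum>i\<le>?m. a \<cdot> coeff r i \<cdot> (T ^^ i) y) = a \<cdot> ev r"
      unfolding ev_upto[OF le_SucI[OF order_refl], of r] by (rule scale_sum_right[symmetric])
    finally show ?thesis .
  qed
  define p0 where "p0 = (\<Sum>i\<le>n. monom (c i) i)"
  have coeff_p0: "coeff p0 i = (if i \<le> n then c i else 0)" for i
    unfolding p0_def by (simp add: coeff_sum)
  have "degree p0 \<le> n"
    by (intro degree_le) (simp add: coeff_p0)
  then have "ev p0 = 0"
    using dep(1) by (simp add: ev_upto[of _ n] coeff_p0)
  moreover have "p0 \<noteq> 0"
    using dep(2) coeff_p0 by (metis coeff_0)
  ultimately obtain p where p: "p \<noteq> 0" "ev p = 0"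
      and min: "\<And>r. r \<noteq> 0 \<Longrightarrow> ev r = 0 \<Longrightarrow> degree p \<le> degree r"
    using ex_has_least_nat[of "\<lambda>p. p \<noteq> 0 \<and> ev p = 0" p0 degree] by blast
  \<comment> \<open>A nonzero constant cannot annihilate \<open>y \<noteq> 0\<close>.\<close>
  have "degree p > 0"
  proof (rule ccontr)
    assume d: "\<not> degree p > 0"
    then have "coeff p 0 \<noteq> 0" using p(1) by (metis leading_coeff_0_iff not_gr0)
    then show False using p(2) d F(4) by (simp add: ev_def)
  qed
  then obtain a where "poly p a = 0" using alg_closed by blast
  then obtain r where r: "p = [:-a, 1:] * r" by (auto simp: poly_eq_0_iff_dvd)
  with p have "r \<noteq> 0" by auto
  then have "degree p = Suc (degree r)"
    unfolding r by (subst degree_mult_eq) auto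
  then have "ev r \<noteq> 0" using min[OF \<open>r \<noteq> 0\<close>] by fastforce
  moreover have "T (ev r) = a \<cdot> ev r"
    using p(2) unfolding r ev_factor by simp
  ultimately show ?thesis using ev_F by blast
qed

section \<open>Spectral theorem for a Hermitian pencil\<close>

context hermitian_pencil
begin

text \<open>The weak eigenvalue equation. It mentions no operator, so on a subspace it describes the
  eigenvectors of the compression.\<close>

definition eigenspace :: "complex \<Rightarrow> 'a set" where
  "eigenspace a = {y \<in> E. \<forall>x\<in>E. h x y = a * g x y}"

lemma eigenvalue_real:
  assumes "y \<in> eigenspace a" "y \<noteq> 0"
  shows "a = of_real (Re a)"
proof -
  have y: "y \<in> E" "h y y = a * g y y" using assms by (auto simp: eigenspace_def)
  have "Im (h y y) = 0" "Im (g y y) = 0" using h_diag_real[of y] g_diag_real[of y]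
    by (metis Im_complex_of_real)+
  then have "Im a * Re (g y y) = 0" using y(2) by simp
  then show ?thesis using g_pos[OF y(1) assms(2)] by (simp add: complex_eq_iff)
qed

text \<open>The operator \<open>T\<close> below represents \<open>h\<close> with respect to \<open>g\<close>; it leaves the complement
  of a set of eigenvectors invariant.\<close>
lemma eigenvector_in_complement:
  assumes S: "S \<subseteq> E" "\<forall>s\<in>S. \<exists>r::real. s \<in> eigenspace (of_real r)"
    and y: "y \<in> E" "y \<noteq> 0" "\<forall>s\<in>S. g s y = 0"
  shows "\<exists>z\<in>E. (\<exists>r::real. z \<in> eigenspace (of_real r)) \<and> z \<noteq> 0 \<and> (\<forall>s\<in>S. g s z = 0)"
proof -
  obtain U where U: "orthonormal U" "\<forall>y\<in>E. (\<forall>s\<in>U. g s y = 0) \<longrightarrow> y = 0"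
    using orthonormal_basis_exists by blast
  have finU: "finite U" and UE: "U \<subseteq> E" using U by (auto simp: orthonormal_def)
  define T where "T x = (\<Sum>u\<in>U. h u x \<cdot> u)" for x
  have TE: "T x \<in> E" for x
    unfolding T_def using UE by (intro subspace_sum subspace_scale subspace_E) auto
  have gT: "g x (T v) = h x v" if "x \<in> E" for x v
  proof -
    \<comment> \<open>Linearity is available in the second argument only, so \<open>x\<close> is
      expanded inside \<open>h v x\<close> and the result is conjugated back.\<close>
    have "h v x = h v (\<Sum>u\<in>U. g u x \<cdot> u)"
      using complete_expansion[OF U that] by simp
    then have "h x v = cnj (\<Sum>u\<in>U. g u x * h v u)"
      by (subst h_hermitian) (simp add: h_sum h_scale)
    also have "\<dots> = (\<Sum>u\<in>U. h u v * g x u)"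
      by (subst (2) h_hermitian, subst (2) g_hermitian) (simp add: mult.commute)
    finally show ?thesis by (simp add: T_def g_sum g_scale)
  qed
  define F where "F = {v \<in> E. \<forall>s\<in>S. g s v = 0}"
  have F: "subspace F"
    using subspace_E unfolding subspace_def F_def by (auto simp: g_zero g_add g_scale)
  have TF: "T v \<in> F" if "v \<in> F" for v
  proof -
    \<comment> \<open>Here it matters that \<open>s\<close> is an eigenvector: \<open>h s v\<close>
      vanishes together with \<open>g s v\<close>.\<close>
    have "g s (T v) = 0" if s: "s \<in> S" for s
    proof -
      obtain r :: real where r: "s \<in> eigenspace (of_real r)" using S s by blast
      have "g v s = 0" using \<open>v \<in> F\<close> s g_eq_0_commute by (auto simp: F_def)
      then have "h v s = 0" using r \<open>v \<in> F\<close> by (simp add: eigenspace_def F_def)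
      then have "h s v = 0" by (subst h_hermitian) simp
      then show ?thesis using gT S s by auto
    qed
    then show ?thesis using TE by (simp add: F_def)
  qed
  have yF: "y \<in> F" using y by (simp add: F_def)
  have orbit: "(T ^^ i) y \<in> E" for i
    by (induction i) (simp_all add: y TE)
  let ?n = "card U"
  \<comment> \<open>There are \<open>card U + 1\<close> orbit vectors but only \<open>card U\<close>
    coordinates with respect to \<open>U\<close>.\<close>
  obtain c where c: "\<exists>i\<in>{..?n}. c i \<noteq> 0"
      "\<forall>u\<in>U. (\<Sum>i\<in>{..?n}. c i * g u ((T ^^ i) y)) = 0"
    using underdetermined_system_nontrivial[of U "{..?n}" "\<lambda>i u. g u ((T ^^ i) y)"] finU by auto
  have "(\<Sum>i\<le>?n. c i \<cdot> (T ^^ i) y) \<in> E"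
    by (intro subspace_sum subspace_scale subspace_E orbit)
  then have dep: "(\<Sum>i\<le>?n. c i \<cdot> (T ^^ i) y) = 0"
    using U(2) c(2) by (simp add: g_sum g_scale)
  have "\<exists>z\<in>F. z \<noteq> 0 \<and> (\<exists>a. T z = a \<cdot> z)"
  proof (rule eigenvector_of_dependent_orbit[OF vector_space_axioms _ F TF yF y(2) _ _ dep])
    show "\<exists>a. poly p a = 0" if "degree p > 0" for p :: "complex poly"
      using fundamental_theorem_of_algebra[of p] that constant_degree[of p] by auto
    show "T (u + v) = T u + T v" for u v
      by (simp add: T_def h_add scale_left_distrib sum.distrib)
    show "T (b \<cdot> v) = b \<cdot> T v" for b v
      by (simp add: T_def h_scale scale_sum_right)
  qed (use c(1) in auto)
  then obtain z a where z: "z \<in> F" "z \<noteq> 0" "T z = a \<cdot> z" by blast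
  have "z \<in> eigenspace a"
    using z gT[of _ z] by (auto simp: eigenspace_def F_def g_scale)
  with eigenvalue_real[OF this z(2)] have "z \<in> eigenspace (of_real (Re a))" by simp
  then show ?thesis using z by (auto simp: F_def)
qed

text \<open>Indexing by numbers below \<open>m\<close> in nondecreasing order of
  \<open>\<mu>\<close> makes \<open>\<mu> n\<close> the n-th eigenvalue. The length \<open>m\<close>
  is a parameter so that a space and its hyperplane can be compared at lengths \<open>Suc m\<close>
  and \<open>m\<close>.\<close>

definition eigenbasis :: "nat \<Rightarrow> (nat \<Rightarrow> 'a) \<Rightarrow> (nat \<Rightarrow> real) \<Rightarrow> bool" where
  "eigenbasis m e \<mu> \<longleftrightarrow>
     (\<forall>i<m. e i \<in> eigenspace (of_real (\<mu> i))) \<and>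
     (\<forall>i<m. \<forall>j<m. g (e i) (e j) = of_bool (i = j)) \<and>
     (\<forall>i j. i \<le> j \<longrightarrow> j < m \<longrightarrow> \<mu> i \<le> \<mu> j) \<and>
     (\<forall>y\<in>E. y = (\<Sum>i<m. g (e i) y \<cdot> e i))"

text \<open>A maximal orthonormal set of eigenvectors is complete, since a nonzero complement would
  contain a further eigenvector. Sorting it by eigenvalue gives the indexed family.\<close>

theorem eigenbasis_exists: "\<exists>e \<mu>. eigenbasis (dim E) e \<mu>"
proof -
  have eig_scale: "\<exists>r::real. c \<cdot> z \<in> eigenspace (of_real r)"
    if ex: "\<exists>r::real. z \<in> eigenspace (of_real r)" for c z
  proof -
    from ex obtain r :: real where "z \<in> eigenspace (of_real r)" by blast
    then have "c \<cdot> z \<in> eigenspace (of_real r)"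
      using subspace_scale[OF subspace_E] by (simp add: eigenspace_def h_scale g_scale)
    then show ?thesis by blast
  qed
  obtain S where S: "orthonormal S" "\<forall>s\<in>S. \<exists>r::real. s \<in> eigenspace (of_real r)"
      "\<forall>y\<in>E. (\<forall>s\<in>S. g s y = 0) \<longrightarrow> y = 0"
  proof -
    let ?P = "\<lambda>z. \<exists>r::real. z \<in> eigenspace (of_real r)"
    have "\<exists>S. orthonormal S \<and> (\<forall>s\<in>S. ?P s) \<and> (\<forall>y\<in>E. (\<forall>s\<in>S. g s y = 0) \<longrightarrow> y = 0)"
    proof (rule maximal_orthonormal)
      show "?P (c \<cdot> z)" if "?P z" for c z using that by (rule eig_scale)
      show "\<exists>z\<in>E. ?P z \<and> z \<noteq> 0 \<and> (\<forall>s\<in>S. g s z = 0)"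
        if "orthonormal S" "\<forall>s\<in>S. ?P s" "y \<in> E" "y \<noteq> 0" "\<forall>s\<in>S. g s y = 0" for S y
        using that by (intro eigenvector_in_complement) (auto simp: orthonormal_def)
    qed
    then show ?thesis by (elim exE conjE) (rule that)
  qed
  obtain \<nu> :: "'a \<Rightarrow> real" where \<nu>: "\<And>s. s \<in> S \<Longrightarrow> s \<in> eigenspace (of_real (\<nu> s))"
    using bchoice[OF S(2)] by blast
  have "finite S" using S by (simp add: orthonormal_def)
  then obtain xs where xs: "set xs = S" "distinct xs" using finite_distinct_list by blast
  define ys where "ys = sort_key \<nu> xs"
  have ys: "set ys = S" "distinct ys" "sorted (map \<nu> ys)" "length ys = dim E"
    using xs complete_card[OF S(1,3)] distinct_card[of xs] by (simp_all add: ys_def)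
  have "eigenbasis (dim E) (\<lambda>i. ys ! i) (\<lambda>i. \<nu> (ys ! i))"
    unfolding eigenbasis_def
  proof (intro conjI allI impI ballI)
    fix i assume i: "i < dim E"
    then show "ys ! i \<in> eigenspace (of_real (\<nu> (ys ! i)))"
      using \<nu> ys nth_mem by metis
    fix j assume j: "j < dim E"
    have "ys ! i \<in> S" "ys ! j \<in> S" using i j ys nth_mem by metis+
    then show "g (ys ! i) (ys ! j) = of_bool (i = j)"
      using S(1) i j ys by (simp add: orthonormal_def nth_eq_iff_index_eq)
  next
    fix i j assume "i \<le> j" "j < dim E"
    then show "\<nu> (ys ! i) \<le> \<nu> (ys ! j)"
      using ys sorted_nth_mono[of "map \<nu> ys" i j] by simp
  next
    fix y assume y: "y \<in> E"
    have "bij_betw (\<lambda>i. ys ! i) {..<dim E} S"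
      using ys bij_betw_nth by metis
    then have "(\<Sum>i<dim E. g (ys ! i) y \<cdot> ys ! i) = (\<Sum>s\<in>S. g s y \<cdot> s)"
      by (rule sum.reindex_bij_betw)
    with complete_expansion[OF S(1,3) y] show "y = (\<Sum>i<dim E. g (ys ! i) y \<cdot> ys ! i)"
      by (rule trans[OF _ sym])
  qed
  then show ?thesis by blast
qed

section \<open>Multiplicities and Rayleigh quotients in an eigenbasis\<close>

context
  fixes m e \<mu> assumes eb: "eigenbasis m e \<mu>"
begin

lemma eigenbasis_eigenspace: "i < m \<Longrightarrow> e i \<in> eigenspace (of_real (\<mu> i))"
  using eb unfolding eigenbasis_def by blast

lemma eigenbasis_mono: "i \<le> j \<Longrightarrow> j < m \<Longrightarrow> \<mu> i \<le> \<mu> j"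
  using eb unfolding eigenbasis_def by blast

lemma eigenbasis_mem: "i < m \<Longrightarrow> e i \<in> E"
  using eigenbasis_eigenspace by (auto simp: eigenspace_def)

lemma eigenbasis_g: "i < m \<Longrightarrow> j < m \<Longrightarrow> g (e i) (e j) = of_bool (i = j)"
  using eb unfolding eigenbasis_def by blast

lemma eigenbasis_coeff:
  assumes "i < m" "A \<subseteq> {..<m}"
  shows "g (e i) (\<Sum>j\<in>A. c j \<cdot> e j) = (if i \<in> A then c i else 0)"
proof -
  have "finite A" using assms(2) finite_subset by blast
  have "g (e i) (\<Sum>j\<in>A. c j \<cdot> e j) = (\<Sum>j\<in>A. if i = j then c j else 0)"
    unfolding g_sum g_scale using assms by (intro sum.cong) (auto simp: eigenbasis_g)
  then show ?thesis using \<open>finite A\<close> by simp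
qed

lemma eigenbasis_h:
  assumes "i < m" "y \<in> E"
  shows "h (e i) y = of_real (\<mu> i) * g (e i) y"
proof -
  have "h y (e i) = of_real (\<mu> i) * g y (e i)"
    using eigenbasis_eigenspace assms by (auto simp: eigenspace_def)
  then show ?thesis by (subst h_hermitian, subst g_hermitian) simp
qed

lemma eigenbasis_expansion:
  assumes "y \<in> E"
  shows "y = (\<Sum>i<m. g (e i) y \<cdot> e i)"
  using eb assms unfolding eigenbasis_def by blast

lemma eigenbasis_inj: "inj_on e {..<m}"
proof (rule inj_onI)
  fix i j assume "i \<in> {..<m}" "j \<in> {..<m}" "e i = e j"
  then show "i = j" using eigenbasis_g[of i i] eigenbasis_g[of i j] by (auto split: if_splits)
qed

text \<open>Evaluating \<open>h (e i) y\<close> from the side of \<open>e i\<close> and from the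
  side of \<open>y\<close> gives \<open>\<mu> i * g (e i) y = a * g (e i) y\<close>, so only
  coefficients with \<open>\<mu> i = a\<close> survive.\<close>

lemma dim_eigenspace: "dim (eigenspace a) = card {i. i < m \<and> of_real (\<mu> i) = a}"
proof (rule dim_unique)
  let ?J = "{i. i < m \<and> of_real (\<mu> i) = a}"
  show "e ` ?J \<subseteq> eigenspace a"
    using eigenbasis_eigenspace by auto
  have "orthonormal (e ` ?J)"
    unfolding orthonormal_def using eigenbasis_g eigenbasis_mem eigenbasis_inj
    by (auto simp: inj_on_def)
  then show "independent (e ` ?J)" by (rule orthonormal_independent)
  show "card (e ` ?J) = card ?J"
    by (intro card_image inj_on_subset[OF eigenbasis_inj]) auto
  show "eigenspace a \<subseteq> span (e ` ?J)"
  proof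
    fix y assume y: "y \<in> eigenspace a"
    then have yE: "y \<in> E" by (simp add: eigenspace_def)
    have coeff: "g (e i) y = 0" if "i < m" "of_real (\<mu> i) \<noteq> a" for i
      using eigenbasis_h[OF that(1) yE] y eigenbasis_mem[OF that(1)] that(2)
      by (simp add: eigenspace_def)
    have "y = (\<Sum>i<m. g (e i) y \<cdot> e i)" using eigenbasis_expansion[OF yE] .
    also have "\<dots> = (\<Sum>i\<in>?J. g (e i) y \<cdot> e i)"
      using coeff by (intro sum.mono_neutral_right) auto
    also have "\<dots> \<in> span (e ` ?J)"
      by (intro span_sum span_scale span_base) auto
    finally show "y \<in> span (e ` ?J)" .
  qed
qed

lemma eigenvalue_iff: "(\<exists>y\<in>eigenspace a. y \<noteq> 0) \<longleftrightarrow> a \<in> (of_real \<circ> \<mu>) ` {..<m}"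
proof
  assume "\<exists>y\<in>eigenspace a. y \<noteq> 0"
  then obtain y where y: "y \<in> eigenspace a" "y \<noteq> 0" by blast
  then have yE: "y \<in> E" by (simp add: eigenspace_def)
  obtain i where i: "i < m" "g (e i) y \<noteq> 0"
    using eigenbasis_expansion[OF yE] y(2)
    by (metis (no_types, lifting) lessThan_iff scale_zero_left sum.neutral)
  then have "of_real (\<mu> i) = a"
    using eigenbasis_h[OF i(1) yE] y eigenbasis_mem[OF i(1)] by (simp add: eigenspace_def)
  then show "a \<in> (of_real \<circ> \<mu>) ` {..<m}" using i by auto
next
  assume "a \<in> (of_real \<circ> \<mu>) ` {..<m}"
  then obtain i where i: "i < m" "a = of_real (\<mu> i)" by auto
  then have "e i \<in> eigenspace a" using eigenbasis_eigenspace by auto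
  moreover have "e i \<noteq> 0" using eigenbasis_g[of i i] i by (auto simp: g_zero)
  ultimately show "\<exists>y\<in>eigenspace a. y \<noteq> 0" by blast
qed

lemma g_expansion:
  assumes "y \<in> E"
  shows "Re (g y y) = (\<Sum>i<m. (cmod (g (e i) y))\<^sup>2)"
proof -
  have "g y y = (\<Sum>i<m. g (e i) y * g y (e i))"
    by (subst (2) eigenbasis_expansion[OF assms]) (simp add: g_sum g_scale)
  also have "\<dots> = (\<Sum>i<m. of_real ((cmod (g (e i) y))\<^sup>2))"
    by (intro sum.cong refl, subst (2) g_hermitian) (simp add: complex_norm_square del: of_real_power)
  finally show ?thesis by simp
qed

lemma h_expansion:
  assumes "y \<in> E"
  shows "Re (h y y) = (\<Sum>i<m. \<mu> i * (cmod (g (e i) y))\<^sup>2)"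
proof -
  have "h y y = (\<Sum>i<m. g (e i) y * h y (e i))"
    by (subst (2) eigenbasis_expansion[OF assms]) (simp add: h_sum h_scale)
  also have "\<dots> = (\<Sum>i<m. of_real (\<mu> i * (cmod (g (e i) y))\<^sup>2))"
  proof (intro sum.cong refl)
    fix i assume "i \<in> {..<m}"
    then have "h y (e i) = of_real (\<mu> i) * cnj (g (e i) y)"
      by (subst h_hermitian) (simp add: eigenbasis_h assms)
    then show "g (e i) y * h y (e i) = of_real (\<mu> i * (cmod (g (e i) y))\<^sup>2)"
      by (simp add: complex_norm_square mult_ac del: of_real_power)
  qed
  finally show ?thesis by simp
qed

text \<open>In coordinates \<open>g\<close> and \<open>h\<close> are sums of squares with weights 1
  and \<open>\<mu> i\<close>. The terms below \<open>n\<close> vanish and all others have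
  \<open>\<mu> i \<ge> \<mu> n\<close>.\<close>

lemma rayleigh_ge:
  assumes "y \<in> E" "n < m" "\<forall>i<n. g (e i) y = 0"
  shows "\<mu> n * Re (g y y) \<le> Re (h y y)"
  unfolding g_expansion[OF assms(1)] h_expansion[OF assms(1)] sum_distrib_left
proof (rule sum_mono)
  fix i assume i: "i \<in> {..<m}"
  show "\<mu> n * (cmod (g (e i) y))\<^sup>2 \<le> \<mu> i * (cmod (g (e i) y))\<^sup>2"
  proof (cases "i < n")
    case False
    then have "\<mu> n \<le> \<mu> i" using eigenbasis_mono i by simp
    then show ?thesis by (rule mult_right_mono) simp
  qed (simp add: assms(3))
qed

lemma rayleigh_le:
  assumes "y \<in> E" "n < m" "\<forall>i<m. n < i \<longrightarrow> g (e i) y = 0"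
  shows "Re (h y y) \<le> \<mu> n * Re (g y y)"
  unfolding g_expansion[OF assms(1)] h_expansion[OF assms(1)] sum_distrib_left
proof (rule sum_mono)
  fix i assume i: "i \<in> {..<m}"
  show "\<mu> i * (cmod (g (e i) y))\<^sup>2 \<le> \<mu> n * (cmod (g (e i) y))\<^sup>2"
  proof (cases "n < i")
    case False
    then have "\<mu> i \<le> \<mu> n" using eigenbasis_mono assms(2) by simp
    then show ?thesis by (rule mult_right_mono) simp
  qed (use assms(3) i in simp)
qed

text \<open>The \<open>n + 1\<close> coefficients of a combination of \<open>e 0\<close>, ...,
  \<open>e n\<close> face at most \<open>n\<close> linear conditions; orthogonality to the later
  \<open>e i\<close> is automatic.\<close>

lemma eigenbasis_combination_test_vector:
  assumes "n < m" "finite J" "card J \<le> n"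
    and add: "\<And>j y z. \<phi> j (y + z) = \<phi> j y + \<phi> j z"
    and scale: "\<And>j c y. \<phi> j (c \<cdot> y) = c * \<phi> j y"
  shows "\<exists>y\<in>E. y \<noteq> 0 \<and> (\<forall>j\<in>J. \<phi> j y = 0) \<and> (\<forall>i<m. n < i \<longrightarrow> g (e i) y = 0)"
proof -
  have \<phi>_sum: "\<phi> j (\<Sum>i\<in>A. G i) = (\<Sum>i\<in>A. \<phi> j (G i))" for j and A :: "nat set" and G
    using scale[of j 0 0] by (induction A rule: infinite_finite_induct) (simp_all add: add)
  obtain c where c: "\<exists>i\<in>{..n}. c i \<noteq> 0" "\<forall>j\<in>J. (\<Sum>i\<in>{..n}. c i * \<phi> j (e i)) = 0"
    using underdetermined_system_nontrivial[of J "{..n}" "\<lambda>i j. \<phi> j (e i)"] assms(2,3) by auto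
  let ?y = "\<Sum>i\<le>n. c i \<cdot> e i"
  have co: "g (e i) ?y = (if i \<in> {..n} then c i else 0)" if "i < m" for i
    using assms(1) that by (intro eigenbasis_coeff) auto
  have "?y \<noteq> 0"
  proof
    assume "?y = 0"
    then have "c i = 0" if "i \<le> n" for i
      using co[of i] that assms(1) by (simp add: g_zero)
    then show False using c(1) by auto
  qed
  moreover have "?y \<in> E"
    using assms(1) by (intro subspace_sum subspace_scale subspace_E eigenbasis_mem) auto
  ultimately show ?thesis
    using c(2) co by (intro bexI[of _ ?y]) (auto simp: \<phi>_sum scale)
qed

end

end

section \<open>Cauchy interlacing for a hyperplane\<close>

text \<open>A dimension count produces a nonzero vector whose Rayleigh quotient
  separates the two eigenvalues in question.\<close>
theorem interlacing_hyperplane: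
  fixes scale :: "complex \<Rightarrow> 'a::ab_group_add \<Rightarrow> 'a"
  assumes E: "hermitian_pencil scale E g h" and U: "hermitian_pencil scale U g h"
    and U_eq: "U = {y \<in> E. \<psi> y = 0}"
    and \<psi>_add: "\<And>y z. \<psi> (y + z) = \<psi> y + \<psi> z"
    and \<psi>_scale: "\<And>c y. \<psi> (scale c y) = c * (\<psi> y :: complex)"
    and e: "hermitian_pencil.eigenbasis scale E g h (Suc m) e \<mu>"
    and e': "hermitian_pencil.eigenbasis scale U g h m e' \<mu>'"
    and n: "n < m"
  shows "\<mu> n \<le> \<mu>' n \<and> \<mu>' n \<le> \<mu> (Suc n)"
proof
  interpret E: hermitian_pencil scale E g h by fact
  interpret U: hermitian_pencil scale U g h by fact
  have sub: "U \<subseteq> E" using U_eq by blast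
  \<comment> \<open>A vector in the span of \<open>e' 0\<close>, ..., \<open>e' n\<close> orthogonal
    to \<open>e 0\<close>, ..., \<open>e (n-1)\<close>: its quotient is at least
    \<open>\<mu> n\<close> and at most \<open>\<mu>' n\<close>.\<close>
  have "\<exists>y\<in>U. y \<noteq> 0 \<and> (\<forall>j\<in>{..<n}. g (e j) y = 0) \<and> (\<forall>i<m. n < i \<longrightarrow> g (e' i) y = 0)"
    using n by (intro U.eigenbasis_combination_test_vector[OF e']) (auto simp: E.g_add E.g_scale)
  then obtain y where y: "y \<in> U" "y \<noteq> 0" "\<forall>j<n. g (e j) y = 0" "\<forall>i<m. n < i \<longrightarrow> g (e' i) y = 0"
    by auto
  have "\<mu> n * Re (g y y) \<le> Re (h y y)"
    using y sub n by (intro E.rayleigh_ge[OF e]) auto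
  also have "\<dots> \<le> \<mu>' n * Re (g y y)"
    using y n by (intro U.rayleigh_le[OF e']) auto
  finally show "\<mu> n \<le> \<mu>' n" using U.g_pos[OF y(1,2)] by simp
next
  interpret E: hermitian_pencil scale E g h by fact
  interpret U: hermitian_pencil scale U g h by fact
  \<comment> \<open>The slot \<open>j = n\<close> carries the hyperplane condition. This extra
    condition costs one more basis vector, hence \<open>Suc n\<close> in the upper bound.\<close>
  let ?\<phi> = "\<lambda>j y. if j = n then \<psi> y else g (e' j) y"
  have "\<exists>y\<in>E. y \<noteq> 0 \<and> (\<forall>j\<in>{..n}. ?\<phi> j y = 0) \<and> (\<forall>i<Suc m. Suc n < i \<longrightarrow> g (e i) y = 0)"
    using n by (intro E.eigenbasis_combination_test_vector[OF e])
      (auto simp: E.g_add E.g_scale \<psi>_add \<psi>_scale)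
  then obtain y where y: "y \<in> E" "y \<noteq> 0" "\<forall>j\<in>{..n}. ?\<phi> j y = 0"
      "\<forall>i<Suc m. Suc n < i \<longrightarrow> g (e i) y = 0" by auto
  from y(3) have "\<psi> y = 0" and orth: "\<forall>j<n. g (e' j) y = 0"
    by (auto split: if_splits)
  with y have yU: "y \<in> U" by (simp add: U_eq)
  have "\<mu>' n * Re (g y y) \<le> Re (h y y)"
    using yU orth n by (intro U.rayleigh_ge[OF e']) auto
  also have "\<dots> \<le> \<mu> (Suc n) * Re (g y y)"
    using y n by (intro E.rayleigh_le[OF e]) auto
  finally show "\<mu>' n \<le> \<mu> (Suc n)" using U.g_pos[OF yU y(2)] by simp
qed

text \<open>Injectivity is required on \<open>S\<close> alone because \<open>trunc\<close>, to which
  this is applied, is injective on solution spaces but not on all sequences.\<close>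

lemma dim_image_inj_on:
  assumes "Vector_Spaces.linear s1 s2 f" "module.subspace s1 S" "inj_on f S"
  shows "vector_space.dim s2 (f ` S) = vector_space.dim s1 S"
proof -
  interpret Vector_Spaces.linear s1 s2 f by fact
  obtain B where B: "B \<subseteq> S" "vs1.independent B" "S \<subseteq> vs1.span B" "card B = vs1.dim S"
    using vs1.basis_exists by blast
  have span: "vs1.span B = S"
    using B assms(2) by (simp add: subset_antisym vs1.span_minimal)
  have "vs2.dim (f ` S) = card (f ` B)"
  proof (rule vs2.dim_unique[OF _ _ _ refl])
    show "f ` B \<subseteq> f ` S" using B by blast
    show "f ` S \<subseteq> vs2.span (f ` B)" using span span_image by blast
    show "vs2.independent (f ` B)"
      using independent_injective_image[of B] B(2) assms(3) span by simp
  qed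
  also have "\<dots> = card B"
    using B(1) assms(3) inj_on_subset by (intro card_image) blast
  finally show ?thesis using B(4) by simp
qed

subsection \<open>Sequence spaces and spectra\<close>

abbreviation (input) cscale :: "complex \<Rightarrow> (nat \<Rightarrow> complex) \<Rightarrow> nat \<Rightarrow> complex" where
  "cscale \<equiv> \<lambda>c y. (\<lambda>n. c * y n)"

interpretation seq: vector_space cscale
  by unfold_locales (auto simp: plus_fun_def algebra_simps)

lemma sum_seq_apply: "(\<Sum>i\<in>A. F i) n = (\<Sum>i\<in>A. (F i n :: complex))"
  by (induction A rule: infinite_finite_induct) (simp_all add: plus_fun_def zero_fun_def)

text \<open>The family \<open>b\<close> is dual to the coordinates in \<open>I\<close>: subtracting
  the combination of the \<open>b i\<close> with the coordinates of \<open>y\<close> leaves a vector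
  that \<open>determined\<close> forces to be 0.\<close>

lemma seq_dim_coordinates:
  assumes V: "seq.subspace V" and I: "finite I"
    and determined: "\<And>y. y \<in> V \<Longrightarrow> \<forall>i\<in>I. y i = 0 \<Longrightarrow> y = 0"
    and b: "\<And>i. i \<in> I \<Longrightarrow> b i \<in> V" "\<And>i j. i \<in> I \<Longrightarrow> j \<in> I \<Longrightarrow> b i j = of_bool (i = j)"
  shows "seq.dim V = card I" "V \<subseteq> seq.span (b ` I)"
proof -
  have eval: "(\<Sum>i\<in>I. cscale (c i) (b i)) j = c j" if "j \<in> I" for c j
  proof -
    have "(\<Sum>i\<in>I. cscale (c i) (b i)) j = (\<Sum>i\<in>I. if i = j then c i else 0)"
      unfolding sum_seq_apply using that b by (intro sum.cong) auto
    then show ?thesis using I that by simp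
  qed
  have inj: "inj_on b I"
  proof (rule inj_onI)
    fix i j assume i: "i \<in> I" and j: "j \<in> I" and eq: "b i = b j"
    have "of_bool (i = i) = (of_bool (j = i) :: complex)"
      using fun_cong[OF eq, of i] unfolding b(2)[OF i i] b(2)[OF j i] .
    then show "i = j" by simp
  qed
  show span: "V \<subseteq> seq.span (b ` I)"
  proof
    fix y assume y: "y \<in> V"
    let ?s = "\<Sum>i\<in>I. cscale (y i) (b i)"
    have "y - ?s \<in> V"
      using b(1) by (intro seq.subspace_diff[OF V y] seq.subspace_sum[OF V] seq.subspace_scale[OF V])
    moreover have "\<forall>i\<in>I. (y - ?s) i = 0"
      using eval[of _ y] by (simp add: fun_diff_def)
    ultimately have "y - ?s = 0" by (rule determined)
    then have "y = ?s" by (rule eq_iff_diff_eq_0[THEN iffD2])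
    moreover have "?s \<in> seq.span (b ` I)"
      by (intro seq.span_sum seq.span_scale seq.span_base) auto
    ultimately show "y \<in> seq.span (b ` I)" by metis
  qed
  have "seq.independent (b ` I)"
  proof (rule seq.independent_if_scalars_zero)
    fix c x assume c: "(\<Sum>x\<in>b ` I. cscale (c x) x) = 0" and "x \<in> b ` I"
    then obtain i where i: "i \<in> I" "x = b i" by blast
    have "(\<Sum>j\<in>I. cscale (c (b j)) (b j)) = 0"
      using c by (simp add: sum.reindex[OF inj] o_def)
    then show "c x = 0" using eval[OF i(1), of "\<lambda>j. c (b j)"] i by (simp add: zero_fun_def)
  qed (use I in simp)
  then show "seq.dim V = card I"
    using span b(1) card_image[OF inj] by (intro seq.dim_unique) auto
qed

lemma sum_replicate_mset_card_fibres:
  assumes "finite S"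
  shows "(\<Sum>a\<in>\<phi> ` S. replicate_mset (card {i \<in> S. \<phi> i = a}) a) = image_mset \<phi> (mset_set S)"
proof (rule multiset_eqI)
  fix b
  have "count (\<Sum>a\<in>\<phi> ` S. replicate_mset (card {i \<in> S. \<phi> i = a}) a) b
      = (\<Sum>a\<in>\<phi> ` S. if a = b then card {i \<in> S. \<phi> i = a} else 0)"
    unfolding count_sum by (intro sum.cong) auto
  also have "\<dots> = card {i \<in> S. \<phi> i = b}"
    using assms by (auto simp: image_iff)
  also have "{i \<in> S. \<phi> i = b} = \<phi> -` {b} \<inter> S" by auto
  also have "card \<dots> = count (image_mset \<phi> (mset_set S)) b"
    using assms by (simp add: count_image_mset)
  finally show "count (\<Sum>a\<in>\<phi> ` S. replicate_mset (card {i \<in> S. \<phi> i = a}) a) b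
    = count (image_mset \<phi> (mset_set S)) b" .
qed

text \<open>\<open>P\<close> carries each solution space isomorphically onto a weak eigenspace.
  Multiplicities are therefore fibre sizes of \<open>\<mu>\<close>, and the eigenvalue multiset is
  that of the already sorted list \<open>\<mu> 0\<close>, ..., \<open>\<mu> (m-1)\<close>.\<close>

lemma sl_spectrum_of_pencil:
  assumes V: "hermitian_pencil cscale V g h"
    and e: "hermitian_pencil.eigenbasis cscale V g h m e \<mu>"
    and P: "Vector_Spaces.linear cscale cscale P"
    and inj: "\<And>lam. inj_on P (sl_solution_space f q w N A B lam)"
    and img: "\<And>lam. P ` sl_solution_space f q w N A B lam = hermitian_pencil.eigenspace V g h lam"
    and sub: "\<And>lam. seq.subspace (sl_solution_space f q w N A B lam)"
  shows "sl_has_exactly f q w N A B m" and "\<And>n. n < m \<Longrightarrow> sl_lambda f q w N A B n = \<mu> n"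
proof -
  interpret V: hermitian_pencil cscale V g h by fact
  interpret P: Vector_Spaces.linear cscale cscale P by fact
  have mult: "sl_mult f q w N A B lam = card {i \<in> {..<m}. (of_real \<circ> \<mu>) i = lam}" for lam
    unfolding sl_mult_def using dim_image_inj_on[OF P sub inj, of lam] V.dim_eigenspace[OF e, of lam]
    by (simp add: img)
  have "(\<exists>y\<in>sl_solution_space f q w N A B lam. y \<noteq> 0) \<longleftrightarrow> (\<exists>y\<in>V.eigenspace lam. y \<noteq> 0)" for lam
  proof -
    have "P y = 0 \<longleftrightarrow> y = 0" if "y \<in> sl_solution_space f q w N A B lam" for y
      using inj_onD[OF inj[of lam], of y 0] that seq.subspace_0[OF sub] P.zero by auto
    then show ?thesis unfolding img[symmetric] by auto
  qed
  then have eigs: "sl_eigenvalues f q w N A B = (of_real \<circ> \<mu>) ` {..<m}"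
    unfolding sl_eigenvalues_def using V.eigenvalue_iff[OF e]
    by (auto simp: sl_solution_space_def)
  have mset: "sl_eig_mset f q w N A B = image_mset (of_real \<circ> \<mu>) (mset_set {..<m})"
    unfolding sl_eig_mset_def eigs mult by (rule sum_replicate_mset_card_fibres) simp
  show "sl_has_exactly f q w N A B m"
    unfolding sl_has_exactly_def mset eigs by simp
  fix n assume n: "n < m"
  have "image_mset Re (sl_eig_mset f q w N A B) = mset (map \<mu> [0..<m])"
    unfolding mset by (simp add: multiset.map_comp o_def atLeast0LessThan mset_map)
  moreover have "sorted (map \<mu> [0..<m])"
    by (auto simp: sorted_iff_nth_mono intro: V.eigenbasis_mono[OF e])
  ultimately have "sorted_list_of_multiset (image_mset Re (sl_eig_mset f q w N A B)) = map \<mu> [0..<m]"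
    by (simp only: sorted_list_of_multiset_mset sorted_sort_id)
  then show "sl_lambda f q w N A B n = \<mu> n"
    using n by (simp add: sl_lambda_def)
qed

subsection \<open>The Sturm-Liouville problem\<close>

definition sl_op :: "(nat \<Rightarrow> real) \<Rightarrow> (nat \<Rightarrow> real) \<Rightarrow> (nat \<Rightarrow> complex) \<Rightarrow> nat \<Rightarrow> complex" where
  "sl_op f q y n = - (of_real (f n) * (y (n+1) - y n) - of_real (f (n-1)) * (y n - y (n-1)))
     + of_real (q n) * y n"

lemma sl_solution_cis_mat_iff:
  "sl_solution f q w N (cis_mat \<gamma> L) (- mat 1) lam y \<longleftrightarrow>
     (\<forall>n > N + 1. y n = 0) \<and>
     (\<forall>n\<in>{1..N}. sl_op f q y n = lam * of_real (w n) * y n) \<and>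
     y N = cis \<gamma> * (of_real (L$1$1) * y 0 + of_real (L$1$2) * (of_real (f 0) * (y 1 - y 0))) \<and>
     of_real (f N) * (y (N+1) - y N)
       = cis \<gamma> * (of_real (L$2$1) * y 0 + of_real (L$2$2) * (of_real (f 0) * (y 1 - y 0)))"
proof -
  have "(cis_mat \<gamma> L *v vector [u, v] + (- mat 1) *v vector [p, r] = 0) \<longleftrightarrow>
    p = cis \<gamma> * (of_real (L$1$1) * u + of_real (L$1$2) * v) \<and>
    r = cis \<gamma> * (of_real (L$2$1) * u + of_real (L$2$2) * v)" for u v p r :: complex
    by (simp add: vec_eq_iff forall_2 matrix_vector_mult_def sum_2 cis_mat_def mat_def
        algebra_simps eq_commute[of p] eq_commute[of r])
  then show ?thesis unfolding sl_solution_def sl_op_def by simp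
qed

lemma sl_op_add: "sl_op f q (y + z) n = sl_op f q y n + sl_op f q z n"
  by (simp add: sl_op_def plus_fun_def algebra_simps)

lemma sl_op_scale: "sl_op f q (cscale c y) n = c * sl_op f q y n"
  by (simp add: sl_op_def algebra_simps)

text \<open>Summation by parts: the \<open>q\<close> terms cancel because \<open>q\<close> is real,
  and the rest telescopes.\<close>

lemma sl_lagrange_identity:
  "(\<Sum>n=1..N. cnj (x n) * sl_op f q y n - y n * cnj (sl_op f q x n)) =
     of_real (f 0) * (cnj (x 0) * (y 1 - y 0) - y 0 * cnj (x 1 - x 0)) -
     of_real (f N) * (cnj (x N) * (y (N+1) - y N) - y N * cnj (x (N+1) - x N))"
proof (induction N)
  case (Suc N)
  then show ?case by (simp add: sl_op_def algebra_simps)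
qed simp

lemma sl_solution_subspace:
  "seq.subspace (sl_solution_space f q w N (cis_mat \<gamma> L) (- mat 1) lam)"
proof -
  let ?sol = "sl_solution f q w N (cis_mat \<gamma> L) (- mat 1) lam"
  have add: "?sol (x + y)" if "?sol x" "?sol y" for x y
  proof -
    note x = that(1)[unfolded sl_solution_cis_mat_iff] and y = that(2)[unfolded sl_solution_cis_mat_iff]
    note bcx = x[THEN conjunct2, THEN conjunct2] and bcy = y[THEN conjunct2, THEN conjunct2]
    show ?thesis
      unfolding sl_solution_cis_mat_iff sl_op_add plus_fun_apply
    proof (intro conjI)
      show "\<forall>n>N + 1. x n + y n = 0"
        "\<forall>n\<in>{1..N}. sl_op f q x n + sl_op f q y n = lam * of_real (w n) * (x n + y n)"
        using x y by (simp_all add: distrib_left)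
    qed (use conjunct1[OF bcx] conjunct1[OF bcy] in algebra, use conjunct2[OF bcx] conjunct2[OF bcy] in algebra)
  qed
  have scale: "?sol (cscale c x)" if "?sol x" for c x
  proof -
    note x = that[unfolded sl_solution_cis_mat_iff]
    note bcx = x[THEN conjunct2, THEN conjunct2]
    show ?thesis
      unfolding sl_solution_cis_mat_iff sl_op_scale
    proof (intro conjI)
      show "\<forall>n>N + 1. c * x n = 0"
        "\<forall>n\<in>{1..N}. c * sl_op f q x n = lam * of_real (w n) * (c * x n)"
        using x by simp_all
    qed (use conjunct1[OF bcx] in algebra, use conjunct2[OF bcx] in algebra)
  qed
  have "?sol 0"
    unfolding sl_solution_cis_mat_iff by (simp add: sl_op_def)
  then show ?thesis
    using add scale by (simp add: seq.subspace_def sl_solution_space_def)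
qed

section \<open>Interior values as a model of \<open>\<complex>\<^sup>N\<close>\<close>

definition supported :: "nat \<Rightarrow> (nat \<Rightarrow> complex) set" where
  "supported N = {y. \<forall>n. n \<notin> {1..N} \<longrightarrow> y n = 0}"

definition trunc :: "nat \<Rightarrow> (nat \<Rightarrow> complex) \<Rightarrow> nat \<Rightarrow> complex" where
  "trunc N y = (\<lambda>n. if n \<in> {1..N} then y n else 0)"

definition weighted :: "nat \<Rightarrow> (nat \<Rightarrow> real) \<Rightarrow> (nat \<Rightarrow> complex) \<Rightarrow> (nat \<Rightarrow> complex) \<Rightarrow> complex" where
  "weighted N w x y = (\<Sum>n=1..N. cnj (x n) * (of_real (w n) * y n))"

lemma linear_trunc: "Vector_Spaces.linear cscale cscale (trunc N)"
  by unfold_locales (auto simp: trunc_def plus_fun_def)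

text \<open>The equation at 1 recovers \<open>y 0\<close> since \<open>f 0 \<noteq> 0\<close>, and
  the equation at \<open>N\<close> recovers \<open>y (N+1)\<close> since
  \<open>f N \<noteq> 0\<close>. \<open>N \<ge> 2\<close> ensures that the other neighbours involved
  are interior.\<close>

lemma trunc_inj_on_solutions:
  assumes "N \<ge> 2" "f 0 \<noteq> 0" "f N \<noteq> 0"
  shows "inj_on (trunc N) (sl_solution_space f q w N (cis_mat \<gamma> L) (- mat 1) lam)"
proof (rule inj_onI)
  fix y z
  assume "y \<in> sl_solution_space f q w N (cis_mat \<gamma> L) (- mat 1) lam"
    and "z \<in> sl_solution_space f q w N (cis_mat \<gamma> L) (- mat 1) lam" and tr: "trunc N y = trunc N z"
  then have y: "\<forall>n > N + 1. y n = 0" "\<forall>n\<in>{1..N}. sl_op f q y n = lam * of_real (w n) * y n"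
    and z: "\<forall>n > N + 1. z n = 0" "\<forall>n\<in>{1..N}. sl_op f q z n = lam * of_real (w n) * z n"
    by (simp_all add: sl_solution_space_def sl_solution_cis_mat_iff)
  have mid: "y n = z n" if "n \<in> {1..N}" for n
    using fun_cong[OF tr, of n] that by (simp add: trunc_def)
  have eq: "sl_op f q y n = sl_op f q z n" if "n \<in> {1..N}" for n
    using y z mid that by simp
  have "y 0 = z 0"
    using eq[of 1] mid[of 1] mid[of 2] assms by (simp add: sl_op_def numeral_2_eq_2)
  moreover have "y (N+1) = z (N+1)"
    using eq[of N] mid[of "N - 1"] mid[of N] assms by (simp add: sl_op_def)
  moreover have "n = 0 \<or> n \<in> {1..N} \<or> n = N + 1 \<or> n > N + 1" for n by auto
  ultimately show "y = z" using mid y z by (metis ext)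
qed

section \<open>The regular problem as a Hermitian pencil\<close>

locale regular_sl =
  fixes f q w :: "nat \<Rightarrow> real" and N :: nat and \<gamma> :: real and K :: "real^2^2"
  assumes N: "N \<ge> 2" and f0: "f 0 \<noteq> 0" and fN: "f N \<noteq> 0"
    and w_pos: "n \<in> {1..N} \<Longrightarrow> w n > 0"
    and det_K: "K$1$1 * K$2$2 - K$1$2 * K$2$1 = 1"
    and regular: "K$1$1 - f 0 * K$1$2 \<noteq> 0"
begin

text \<open>Regularity makes the boundary condition solvable for \<open>y 0\<close> and for the flux
  \<open>f N * (y (N+1) - y N)\<close> in terms of \<open>y 1\<close> and \<open>y N\<close>.\<close>
definition left_val :: "(nat \<Rightarrow> complex) \<Rightarrow> complex" where
  "left_val y = (cis (- \<gamma>) * y N - of_real (f 0 * K$1$2) * y 1) / of_real (K$1$1 - f 0 * K$1$2)"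

definition right_flux :: "(nat \<Rightarrow> complex) \<Rightarrow> complex" where
  "right_flux y = cis \<gamma> * (of_real (K$2$1) * left_val y
     + of_real (K$2$2) * (of_real (f 0) * (y 1 - left_val y)))"

text \<open>The inverse of \<open>trunc N\<close> on solutions for \<open>K\<close>. Entry
  \<open>N + 1\<close> comes from dividing the flux by \<open>f N\<close>; the zeros beyond it
  follow the encoding of solutions.\<close>

definition extend :: "(nat \<Rightarrow> complex) \<Rightarrow> nat \<Rightarrow> complex" where
  "extend y n = (if n = 0 then left_val y else if n \<le> N then y n
     else if n = N + 1 then y N + right_flux y / of_real (f N) else 0)"

definition form :: "(nat \<Rightarrow> complex) \<Rightarrow> (nat \<Rightarrow> complex) \<Rightarrow> complex" where
  "form x y = (\<Sum>n=1..N. cnj (x n) * sl_op f q (extend y) n)"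

lemma left_val_add: "left_val (y + z) = left_val y + left_val z"
  by (simp add: left_val_def plus_fun_def algebra_simps add_divide_distrib diff_divide_distrib)

lemma left_val_scale: "left_val (cscale c y) = c * left_val y"
  by (simp add: left_val_def algebra_simps add_divide_distrib diff_divide_distrib)

lemma right_flux_add: "right_flux (y + z) = right_flux y + right_flux z"
  unfolding right_flux_def left_val_add by (simp add: plus_fun_def algebra_simps)

lemma right_flux_scale: "right_flux (cscale c y) = c * right_flux y"
  unfolding right_flux_def left_val_scale by (simp add: algebra_simps)

lemma extend_add: "extend (y + z) = extend y + extend z"
  by (rule ext, unfold plus_fun_def[of "extend y"] extend_def left_val_add right_flux_add)
    (simp add: plus_fun_def add_divide_distrib)

lemma extend_scale: "extend (cscale c y) = cscale c (extend y)"
  unfolding extend_def[abs_def] left_val_scale right_flux_scale by (auto simp: algebra_simps)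

lemma extend_boundary:
  "extend y N = cis \<gamma> * (of_real (K$1$1) * extend y 0
     + of_real (K$1$2) * (of_real (f 0) * (extend y 1 - extend y 0)))"
  "of_real (f N) * (extend y (N+1) - extend y N) = cis \<gamma> * (of_real (K$2$1) * extend y 0
     + of_real (K$2$2) * (of_real (f 0) * (extend y 1 - extend y 0)))"
proof -
  have e: "extend y 0 = left_val y" "extend y 1 = y 1" "extend y N = y N"
    "extend y (N+1) = y N + right_flux y / of_real (f N)"
    using N by (simp_all add: extend_def)
  have "of_real (K$1$1 - f 0 * K$1$2) * left_val y = cis (- \<gamma>) * y N - of_real (f 0 * K$1$2) * y 1"
    using regular unfolding left_val_def by (simp del: of_real_diff)
  then have "of_real (K$1$1) * left_val y + of_real (K$1$2) * (of_real (f 0) * (y 1 - left_val y))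
      = cis (- \<gamma>) * y N"
    by (simp add: algebra_simps)
  moreover have "cis \<gamma> * (cis (- \<gamma>) * y N) = y N"
    by (simp add: cis_mult flip: mult.assoc)
  ultimately show "extend y N = cis \<gamma> * (of_real (K$1$1) * extend y 0
     + of_real (K$1$2) * (of_real (f 0) * (extend y 1 - extend y 0)))"
    unfolding e by simp
  show "of_real (f N) * (extend y (N+1) - extend y N) = cis \<gamma> * (of_real (K$2$1) * extend y 0
     + of_real (K$2$2) * (of_real (f 0) * (extend y 1 - extend y 0)))"
    unfolding e using fN by (simp add: right_flux_def)
qed

text \<open>Lagrange's identity leaves the brackets at 0 and at \<open>N\<close>. The boundary data
  at \<open>N\<close> are \<open>cis \<gamma>\<close> times \<open>K\<close> applied to those at 0;
  \<open>det K = 1\<close> preserves the bracket, and the phase cancels against its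
  conjugate.\<close>

lemma form_hermitian: "form x y = cnj (form y x)"
proof -
  define X where "X = extend x"
  define Y where "Y = extend y"
  define u v u' v' where "u = cnj (X 0)" and "v = cnj (of_real (f 0) * (X 1 - X 0))"
    and "u' = Y 0" and "v' = of_real (f 0) * (Y 1 - Y 0)"
  let ?k11 = "of_real (K$1$1) :: complex" let ?k12 = "of_real (K$1$2) :: complex"
  let ?k21 = "of_real (K$2$1) :: complex" let ?k22 = "of_real (K$2$2) :: complex"
  have bY: "Y N = cis \<gamma> * (?k11 * u' + ?k12 * v')"
      "of_real (f N) * (Y (N+1) - Y N) = cis \<gamma> * (?k21 * u' + ?k22 * v')"
    unfolding u'_def v'_def Y_def by (rule extend_boundary)+
  have bX: "cnj (X N) = cis (- \<gamma>) * (?k11 * u + ?k12 * v)"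
    unfolding u_def v_def X_def by (subst extend_boundary(1)) (simp add: cis_cnj)
  have bX': "cnj (of_real (f N) * (X (N+1) - X N)) = cis (- \<gamma>) * (?k21 * u + ?k22 * v)"
    unfolding u_def v_def X_def by (subst extend_boundary(2)) (simp add: cis_cnj)
  have det: "?k11 * ?k22 - ?k12 * ?k21 = 1"
    using arg_cong[OF det_K, of "of_real :: real \<Rightarrow> complex"] by simp
  have cis1: "cis \<gamma> * cis (- \<gamma>) = 1" by (simp add: cis_mult)
  have "form x y - cnj (form y x) = (\<Sum>n=1..N. cnj (X n) * sl_op f q Y n - Y n * cnj (sl_op f q X n))"
    unfolding form_def X_def Y_def cnj_sum sum_subtractf[symmetric]
    by (intro sum.cong) (auto simp: extend_def)
  also have "\<dots> = (u * v' - u' * v)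
      - (cnj (X N) * (of_real (f N) * (Y (N+1) - Y N)) - Y N * cnj (of_real (f N) * (X (N+1) - X N)))"
    unfolding sl_lagrange_identity u_def v_def u'_def v'_def by (simp add: algebra_simps)
  also have "\<dots> = 0"
    \<comment> \<open>The flux must be rewritten first: its left-hand side contains
      \<open>Y N\<close>, which \<open>bY(1)\<close> would replace.\<close>
    unfolding bX bX' bY(2) unfolding bY(1) using det cis1 by algebra
  finally show ?thesis by simp
qed

lemma weighted_hermitian: "weighted N w x y = cnj (weighted N w y x)"
  unfolding weighted_def cnj_sum by (intro sum.cong) auto

lemma weighted_pos:
  assumes "x \<in> supported N" "x \<noteq> 0"
  shows "Re (weighted N w x x) > 0"
proof -
  obtain n where n: "x n \<noteq> 0" using assms(2) by (auto simp: fun_eq_iff)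
  then have nN: "n \<in> {1..N}" using assms(1) by (auto simp: supported_def)
  have "Re (weighted N w x x) = (\<Sum>n=1..N. w n * (cmod (x n))\<^sup>2)"
    unfolding weighted_def Re_sum
    by (intro sum.cong refl) (simp add: cmod_power2, simp add: power2_eq_square algebra_simps)
  also have "\<dots> > 0"
    using n nN w_pos by (intro sum_pos2[OF _ nN] mult_nonneg_nonneg less_imp_le[OF w_pos]) auto
  finally show ?thesis .
qed

lemma pencil_subspace:
  assumes "seq.subspace V" "V \<subseteq> supported N" "\<exists>B. finite B \<and> V \<subseteq> seq.span B"
  shows "hermitian_pencil cscale V (weighted N w) form"
proof unfold_locales
  show "weighted N w x (y + z) = weighted N w x y + weighted N w x z" for x y z
    by (simp add: weighted_def plus_fun_def algebra_simps sum.distrib)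
  show "weighted N w x (cscale c y) = c * weighted N w x y" for c x y
    by (simp add: weighted_def sum_distrib_left mult_ac)
  show "form x (y + z) = form x y + form x z" for x y z
    by (simp add: form_def extend_add sl_op_add distrib_left sum.distrib)
  show "form x (cscale c y) = c * form x y" for c x y
    by (simp add: form_def extend_scale sl_op_scale sum_distrib_left mult_ac)
  show "weighted N w x y = cnj (weighted N w y x)" "form x y = cnj (form y x)" for x y
    by (rule weighted_hermitian, rule form_hermitian)
qed (use assms weighted_pos in auto)

definition unit_seq :: "nat \<Rightarrow> nat \<Rightarrow> complex" where
  "unit_seq n = (\<lambda>i. of_bool (i = n))"

lemma supported_subspace: "seq.subspace (supported N)"
  by (auto simp: seq.subspace_def supported_def plus_fun_def zero_fun_def)

lemma dim_supported:
  "seq.dim (supported N) = N" "\<exists>B. finite B \<and> supported N \<subseteq> seq.span B"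
proof -
  have "y = 0" if "y \<in> supported N" "\<forall>i\<in>{1..N}. y i = 0" for y
    using that by (auto simp: supported_def fun_eq_iff)
  moreover have "unit_seq i \<in> supported N" if "i \<in> {1..N}" for i
    using that by (auto simp: unit_seq_def supported_def)
  moreover have "unit_seq i j = of_bool (i = j)" for i j
    by (auto simp: unit_seq_def)
  ultimately have "seq.dim (supported N) = card {1..N} \<and>
      supported N \<subseteq> seq.span (unit_seq ` {1..N})"
    by (intro conjI seq_dim_coordinates[of _ _ unit_seq] supported_subspace) simp_all
  then show "seq.dim (supported N) = N" "\<exists>B. finite B \<and> supported N \<subseteq> seq.span B"
    by auto
qed

lemma pencil_supported: "hermitian_pencil cscale (supported N) (weighted N w) form"
  by (intro pencil_subspace supported_subspace dim_supported) simp

text \<open>The defect of \<open>extend y\<close> in the n-th equation. The weak equation says that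
  the test vectors annihilate it.\<close>

definition residual :: "complex \<Rightarrow> (nat \<Rightarrow> complex) \<Rightarrow> nat \<Rightarrow> complex" where
  "residual lam y n = sl_op f q (extend y) n - lam * of_real (w n) * y n"

lemma form_eq_iff: "form x y = lam * weighted N w x y \<longleftrightarrow> (\<Sum>n=1..N. cnj (x n) * residual lam y n) = 0"
  by (simp add: form_def weighted_def residual_def right_diff_distrib sum_subtractf
      sum_distrib_left mult_ac)

text \<open>Every unit sequence in the interior is an admissible test vector, so the weak equation
  forces each residual to vanish separately. \<open>extend\<close> provides the preimage under
  \<open>trunc N\<close>.\<close>

lemma trunc_regular_solutions:
  "trunc N ` sl_solution_space f q w N (cis_mat \<gamma> K) (- mat 1) lam
     = hermitian_pencil.eigenspace (supported N) (weighted N w) form lam"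
proof -
  interpret hermitian_pencil cscale "supported N" "weighted N w" form by (rule pencil_supported)
  have eig: "y \<in> eigenspace lam \<longleftrightarrow> y \<in> supported N \<and> (\<forall>n\<in>{1..N}. residual lam y n = 0)" for y
  proof
    assume y: "y \<in> eigenspace lam"
    have "residual lam y n = 0" if n: "n \<in> {1..N}" for n
    proof -
      have "unit_seq n \<in> supported N" using n by (auto simp: unit_seq_def supported_def)
      then have "form (unit_seq n) y = lam * weighted N w (unit_seq n) y"
        using y by (simp add: eigenspace_def)
      then have "(\<Sum>i=1..N. cnj (unit_seq n i) * residual lam y i) = 0"
        unfolding form_eq_iff .
      moreover have "(\<Sum>i=1..N. cnj (unit_seq n i) * residual lam y i)
          = (\<Sum>i=1..N. if i = n then residual lam y i else 0)"
        by (intro sum.cong) (auto simp: unit_seq_def)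
      ultimately show ?thesis using n by simp
    qed
    then show "y \<in> supported N \<and> (\<forall>n\<in>{1..N}. residual lam y n = 0)"
      using y by (simp add: eigenspace_def)
  qed (auto simp: eigenspace_def form_eq_iff)
  show ?thesis
  proof (intro equalityI subsetI)
    fix z assume "z \<in> trunc N ` sl_solution_space f q w N (cis_mat \<gamma> K) (- mat 1) lam"
    then obtain y where y: "sl_solution f q w N (cis_mat \<gamma> K) (- mat 1) lam y" and z: "z = trunc N y"
      by (auto simp: sl_solution_space_def)
    have z1: "z 1 = y 1" "z N = y N" using N by (auto simp: z trunc_def)
    have bc: "y N = cis \<gamma> * (of_real (K$1$1) * y 0 + of_real (K$1$2) * (of_real (f 0) * (y 1 - y 0)))"
      "of_real (f N) * (y (N+1) - y N)
       = cis \<gamma> * (of_real (K$2$1) * y 0 + of_real (K$2$2) * (of_real (f 0) * (y 1 - y 0)))"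
      using y unfolding sl_solution_cis_mat_iff by blast+
    have "cis (- \<gamma>) * y N = of_real (K$1$1) * y 0 + of_real (K$1$2) * (of_real (f 0) * (y 1 - y 0))"
      unfolding bc(1) by (simp add: cis_mult flip: mult.assoc)
    then have "left_val z = y 0"
      using regular unfolding left_val_def z1
      by (simp add: divide_eq_eq algebra_simps flip: of_real_mult of_real_diff) (simp add: algebra_simps)
    moreover from this have "right_flux z = of_real (f N) * (y (N+1) - y N)"
      unfolding right_flux_def z1 bc(2) by simp
    ultimately have "extend z n = y n" for n
      using y fN N unfolding extend_def
      by (auto simp: z trunc_def sl_solution_cis_mat_iff not_le)
    then have "extend z = y" by blast
    then show "z \<in> eigenspace lam"
      using y unfolding eig by (auto simp: residual_def z trunc_def supported_def sl_solution_cis_mat_iff)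
  next
    fix y assume y: "y \<in> eigenspace lam"
    then have "y \<in> supported N" "\<forall>n\<in>{1..N}. residual lam y n = 0" by (simp_all add: eig)
    then have "sl_solution f q w N (cis_mat \<gamma> K) (- mat 1) lam (extend y)"
      unfolding sl_solution_cis_mat_iff
      by (intro conjI extend_boundary) (auto simp: residual_def extend_def)
    moreover have "trunc N (extend y) = y"
      using \<open>y \<in> supported N\<close> by (auto simp: trunc_def extend_def supported_def fun_eq_iff)
    ultimately show "y \<in> trunc N ` sl_solution_space f q w N (cis_mat \<gamma> K) (- mat 1) lam"
      by (force simp: sl_solution_space_def)
  qed
qed

lemma regular_spectrum:
  assumes "hermitian_pencil.eigenbasis cscale (supported N) (weighted N w) form N e \<mu>"
  shows "sl_has_exactly f q w N (cis_mat \<gamma> K) (- mat 1) N"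
    and "n < N \<Longrightarrow> sl_lambda f q w N (cis_mat \<gamma> K) (- mat 1) n = \<mu> n"
  by (rule sl_spectrum_of_pencil[OF pencil_supported assms linear_trunc
      trunc_inj_on_solutions[OF N f0 fN] trunc_regular_solutions sl_solution_subspace]; assumption?)+

section \<open>The compression to a hyperplane\<close>

text \<open>Written as the kernel of a functional, the form that
  \<open>interlacing_hyperplane\<close> expects.\<close>

definition hyperplane :: "complex \<Rightarrow> (nat \<Rightarrow> complex) set" where
  "hyperplane C = {y \<in> supported N. y N - C * y 1 = 0}"

text \<open>The basis dual to the coordinates \<open>1\<close>, ..., \<open>N - 1\<close>; for
  \<open>n = 1\<close> the entry \<open>C\<close> at \<open>N\<close> keeps the vector in the
  hyperplane.\<close>

definition hyperplane_unit :: "complex \<Rightarrow> nat \<Rightarrow> nat \<Rightarrow> complex" where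
  "hyperplane_unit C n = (\<lambda>i. of_bool (i = n) + (if n = 1 \<and> i = N then C else 0))"

lemma hyperplane_unit_mem: "n \<in> {1..N-1} \<Longrightarrow> hyperplane_unit C n \<in> hyperplane C"
  using N by (auto simp: hyperplane_def hyperplane_unit_def supported_def)

lemma hyperplane_subspace: "seq.subspace (hyperplane C)"
  using supported_subspace unfolding seq.subspace_def hyperplane_def
  by (auto simp: algebra_simps)

lemma dim_hyperplane:
  "seq.dim (hyperplane C) = N - 1" "\<exists>B. finite B \<and> hyperplane C \<subseteq> seq.span B"
proof -
  have "y = 0" if y: "y \<in> hyperplane C" "\<forall>i\<in>{1..N-1}. y i = 0" for y
  proof
    fix n
    have "y N = C * y 1" "y 1 = 0" "\<forall>n. n \<notin> {1..N} \<longrightarrow> y n = 0"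
      using y N by (auto simp: hyperplane_def supported_def)
    moreover have "n \<in> {1..N-1} \<or> n = N \<or> n \<notin> {1..N}" by auto
    ultimately show "y n = 0 n" using y(2) by auto
  qed
  moreover have "hyperplane_unit C i j = of_bool (i = j)" if "j \<in> {1..N-1}" for i j
    using that N by (auto simp: hyperplane_unit_def)
  ultimately have "seq.dim (hyperplane C) = card {1..N-1} \<and>
      hyperplane C \<subseteq> seq.span (hyperplane_unit C ` {1..N-1})"
    by (intro conjI seq_dim_coordinates[of _ _ "hyperplane_unit C"] hyperplane_subspace
        hyperplane_unit_mem) simp_all
  then show "seq.dim (hyperplane C) = N - 1" "\<exists>B. finite B \<and> hyperplane C \<subseteq> seq.span B"
    by auto
qed

lemma pencil_hyperplane: "hermitian_pencil cscale (hyperplane C) (weighted N w) form"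
  by (intro pencil_subspace hyperplane_subspace dim_hyperplane) (auto simp: hyperplane_def)

lemma sum_split_ends:
  "(\<Sum>n=1..N. F n) = F 1 + F N + (\<Sum>n\<in>{2..N-1}. F n :: complex)"
proof -
  have "{1..N} = insert 1 (insert N {2..N-1})" using N by auto
  then show ?thesis using N by simp
qed

text \<open>Test vectors on the hyperplane are free at \<open>2\<close>, ..., \<open>N - 1\<close>,
  but their values at 1 and \<open>N\<close> are coupled. Hence the two end residuals need to vanish
  only in combination.\<close>

lemma hyperplane_eigenspace_iff:
  "y \<in> hermitian_pencil.eigenspace (hyperplane C) (weighted N w) form lam \<longleftrightarrow>
     y \<in> hyperplane C \<and> (\<forall>n\<in>{2..N-1}. residual lam y n = 0)
       \<and> residual lam y 1 + cnj C * residual lam y N = 0"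
proof -
  interpret hermitian_pencil cscale "hyperplane C" "weighted N w" form by (rule pencil_hyperplane)
  show ?thesis
  proof
    assume y: "y \<in> eigenspace lam"
    have test: "(\<Sum>i=1..N. cnj (hyperplane_unit C n i) * residual lam y i) = 0"
      if "n \<in> {1..N-1}" for n
    proof -
      have "form (hyperplane_unit C n) y = lam * weighted N w (hyperplane_unit C n) y"
        using y hyperplane_unit_mem[OF that] by (simp add: eigenspace_def)
      then show ?thesis unfolding form_eq_iff .
    qed
    have "residual lam y n = 0" if n: "n \<in> {2..N-1}" for n
    proof -
      have "(\<Sum>i=1..N. cnj (hyperplane_unit C n i) * residual lam y i)
          = (\<Sum>i=1..N. if i = n then residual lam y i else 0)"
        using n by (intro sum.cong) (auto simp: hyperplane_unit_def)
      moreover have "n \<in> {1..N}" "n \<in> {1..N-1}" using n by auto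
      ultimately show ?thesis using test[of n] by simp
    qed
    moreover have "residual lam y 1 + cnj C * residual lam y N = 0"
    proof -
      have "(\<Sum>i=1..N. cnj (hyperplane_unit C 1 i) * residual lam y i)
          = residual lam y 1 + cnj C * residual lam y N"
        using N unfolding sum_split_ends by (auto simp: hyperplane_unit_def intro!: sum.neutral)
      then show ?thesis using test[of 1] N by simp
    qed
    ultimately show "y \<in> hyperplane C \<and> (\<forall>n\<in>{2..N-1}. residual lam y n = 0)
       \<and> residual lam y 1 + cnj C * residual lam y N = 0"
      using y by (simp add: eigenspace_def)
  next
    assume y: "y \<in> hyperplane C \<and> (\<forall>n\<in>{2..N-1}. residual lam y n = 0)
       \<and> residual lam y 1 + cnj C * residual lam y N = 0"
    have "form x y = lam * weighted N w x y" if "x \<in> hyperplane C" for x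
    proof -
      have xN: "x N = C * x 1" using that by (simp add: hyperplane_def)
      have "(\<Sum>n\<in>{2..N-1}. cnj (x n) * residual lam y n) = 0"
        using y by simp
      then have "(\<Sum>i=1..N. cnj (x i) * residual lam y i)
          = cnj (x 1) * (residual lam y 1 + cnj C * residual lam y N)"
        unfolding sum_split_ends xN by (simp add: distrib_left mult_ac)
      then show ?thesis unfolding form_eq_iff using y by simp
    qed
    then show "y \<in> eigenspace lam" using y by (simp add: eigenspace_def)
  qed
qed

text \<open>\<open>Y\<close> and \<open>extend y\<close> agree on the interior, so only the
  equations at 1 and \<open>N\<close> see a difference: the change of \<open>y 0\<close> and the
  change of flux, respectively.\<close>

lemma sl_op_extend:
  assumes "\<forall>n\<in>{1..N}. Y n = y n"
  shows "n \<in> {2..N-1} \<Longrightarrow> sl_op f q Y n = sl_op f q (extend y) n"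
    and "sl_op f q Y 1 = sl_op f q (extend y) 1 - of_real (f 0) * (Y 0 - left_val y)"
    and "sl_op f q Y N = sl_op f q (extend y) N - (of_real (f N) * (Y (N+1) - Y N) - right_flux y)"
proof -
  show "sl_op f q Y n = sl_op f q (extend y) n" if n: "n \<in> {2..N-1}"
  proof -
    have "k \<in> {1..N}" if "k \<in> {n - 1, n, n + 1}" for k using n that by auto
    then have "Y k = extend y k" if "k \<in> {n - 1, n, n + 1}" for k
      using assms that by (auto simp: extend_def)
    then show ?thesis by (simp add: sl_op_def)
  qed
  have "extend y 0 = left_val y" "extend y 1 = Y 1" "extend y 2 = Y 2"
    using N assms by (simp_all add: extend_def)
  then show "sl_op f q Y 1 = sl_op f q (extend y) 1 - of_real (f 0) * (Y 0 - left_val y)"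
    by (simp add: sl_op_def algebra_simps numeral_2_eq_2)
  have "extend y (N - 1) = Y (N - 1)" "extend y N = Y N"
    "of_real (f N) * (extend y (N+1) - extend y N) = right_flux y"
    using N fN assms by (simp_all add: extend_def)
  then show "sl_op f q Y N = sl_op f q (extend y) N - (of_real (f N) * (Y (N+1) - Y N) - right_flux y)"
    unfolding sl_op_def by simp
qed

end

section \<open>Singular boundary conditions as compressions\<close>

text \<open>The boundary condition \<open>L\<close> is singular, so it forces \<open>y N = cis \<gamma> * L11 * y 1\<close> and leaves
  \<open>y 0\<close> undetermined. On that hyperplane the boundary condition \<open>K\<close> gives \<open>y 0 = t * y 1\<close>;
  \<open>form_match\<close> says that the boundary terms of the two quadratic forms then agree.\<close>
locale singular_sl = regular_sl +
  fixes L :: "real^2^2" and t :: real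
  assumes det_L: "L$1$1 * L$2$2 - L$1$2 * L$2$1 = 1"
    and singular: "L$1$1 = f 0 * L$1$2"
    and t: "(K$1$1 - f 0 * K$1$2) * t = L$1$1 - f 0 * K$1$2"
    and form_match: "f 0 * (1 - t) - L$1$1 * (K$2$1 * t + K$2$2 * (f 0 * (1 - t))) = - (L$1$1 * L$2$1)"
begin

definition C :: complex where
  "C = cis \<gamma> * of_real (L$1$1)"

lemma L11_nz: "L$1$1 \<noteq> 0"
  using singular det_L f0 by auto

lemma cnj_C: "cnj C = cis (- \<gamma>) * of_real (L$1$1)"
  by (simp add: C_def cis_cnj)

lemma left_val_hyperplane:
  assumes "y N = C * y 1"
  shows "left_val y = of_real t * y 1"
proof -
  have "cis (- \<gamma>) * y N = of_real (L$1$1) * y 1"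
    unfolding assms C_def by (simp add: cis_mult flip: mult.assoc)
  then have "left_val y = of_real (L$1$1 - f 0 * K$1$2) * y 1 / of_real (K$1$1 - f 0 * K$1$2)"
    unfolding left_val_def by (simp add: algebra_simps)
  also have "\<dots> = of_real t * y 1"
    unfolding t[symmetric] of_real_mult using regular by (simp del: of_real_diff)
  finally show ?thesis .
qed

text \<open>Here \<open>v\<close> is an arbitrary value for \<open>y 0\<close>, and the two summands
  are the end residuals it produces under the condition \<open>L\<close>. Its coefficient is
  \<open>f 0 + L11 * L21 - f 0 * L11 * L22\<close>, which is 0 by \<open>det_L\<close> and
  \<open>singular\<close>; the multiple of \<open>y 1\<close> that remains is 0 by
  \<open>form_match\<close>.\<close>

lemma boundary_balance:
  assumes "y N = C * y 1"
  shows "of_real (f 0) * (v - left_val y) + cnj C * (cis \<gamma> * (of_real (L$2$1) * v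
    + of_real (L$2$2) * (of_real (f 0) * (y 1 - v))) - right_flux y) = 0"
proof -
  note cast = arg_cong[where f = "of_real :: real \<Rightarrow> complex"]
  have cis1: "cis \<gamma> * cis (- \<gamma>) = 1" by (simp add: cis_mult)
  show ?thesis
    unfolding cnj_C right_flux_def left_val_hyperplane[OF assms]
    using cis1 cast[OF det_L] cast[OF singular] cast[OF form_match]
    unfolding of_real_mult of_real_diff of_real_add of_real_minus of_real_1
    by algebra
qed

text \<open>The residuals at 1 and \<open>N\<close> measure how far a solution for \<open>L\<close>
  deviates from the extension by \<open>K\<close>. \<open>boundary_balance\<close> turns the second
  boundary condition into the coupled end equation, and back again because
  \<open>C \<noteq> 0\<close>.\<close>

lemma trunc_singular_solutions:
  "trunc N ` sl_solution_space f q w N (cis_mat \<gamma> L) (- mat 1) lam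
     = hermitian_pencil.eigenspace (hyperplane C) (weighted N w) form lam"
proof -
  \<comment> \<open>By \<open>singular\<close> the value at 0 drops out of the first boundary
    condition, which becomes the hyperplane equation.\<close>
  have bc1: "cis \<gamma> * (of_real (L$1$1) * u + of_real (L$1$2) * (of_real (f 0) * (v - u))) = C * v"
    for u v
    unfolding C_def singular by (simp add: algebra_simps)
  show ?thesis
  proof (intro equalityI subsetI)
    fix y assume "y \<in> trunc N ` sl_solution_space f q w N (cis_mat \<gamma> L) (- mat 1) lam"
    then obtain Y where "sl_solution f q w N (cis_mat \<gamma> L) (- mat 1) lam Y" and y: "y = trunc N Y"
      by (auto simp: sl_solution_space_def)
    then have Y: "\<And>n. n \<in> {1..N} \<Longrightarrow> sl_op f q Y n = lam * of_real (w n) * Y n"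
      and YN: "Y N = C * Y 1"
      and flux: "of_real (f N) * (Y (N+1) - Y N)
        = cis \<gamma> * (of_real (L$2$1) * Y 0 + of_real (L$2$2) * (of_real (f 0) * (Y 1 - Y 0)))"
      unfolding sl_solution_cis_mat_iff bc1 by blast+
    have Yy: "\<forall>n\<in>{1..N}. Y n = y n"
      by (simp add: y trunc_def)
    have ends: "Y 1 = y 1" "Y N = y N" using Yy N by auto
    have yN: "y N = C * y 1" using YN ends by simp
    have "residual lam y n = 0" if "n \<in> {2..N-1}" for n
    proof -
      have "n \<in> {1..N}" using that by auto
      then show ?thesis
        using Y[of n] Yy sl_op_extend(1)[OF Yy that] by (simp add: residual_def)
    qed
    moreover have "residual lam y 1 = of_real (f 0) * (Y 0 - left_val y)"
      using Y[of 1] sl_op_extend(2)[OF Yy] N ends by (simp add: residual_def diff_eq_eq add.commute)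
    moreover have "residual lam y N = cis \<gamma> * (of_real (L$2$1) * Y 0
        + of_real (L$2$2) * (of_real (f 0) * (y 1 - Y 0))) - right_flux y"
      using Y[of N] sl_op_extend(3)[OF Yy] N ends unfolding flux by (simp add: residual_def diff_eq_eq add.commute)
    ultimately show "y \<in> hermitian_pencil.eigenspace (hyperplane C) (weighted N w) form lam"
      unfolding hyperplane_eigenspace_iff using boundary_balance[OF yN, of "Y 0"] yN
      by (simp add: hyperplane_def supported_def y trunc_def)
  next
    fix y assume "y \<in> hermitian_pencil.eigenspace (hyperplane C) (weighted N w) form lam"
    then have y: "y \<in> supported N" and yN: "y N = C * y 1"
      and inner: "\<And>n. n \<in> {2..N-1} \<Longrightarrow> residual lam y n = 0"
      and balance: "residual lam y 1 + cnj C * residual lam y N = 0"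
      unfolding hyperplane_eigenspace_iff by (auto simp: hyperplane_def)
    \<comment> \<open>The end values are solved from the equations at 1 and \<open>N\<close>, so
      that they absorb the two residuals.\<close>
    define Y where "Y = (\<lambda>n. if n = 0 then left_val y + residual lam y 1 / of_real (f 0)
      else if n = N + 1 then y N + (right_flux y + residual lam y N) / of_real (f N) else y n)"
    have Yy: "\<forall>n\<in>{1..N}. Y n = y n"
      by (simp add: Y_def)
    have ends: "Y 1 = y 1" "Y N = y N" using Yy N by auto
    have r1: "of_real (f 0) * (Y 0 - left_val y) = residual lam y 1"
      using f0 by (simp add: Y_def)
    have rN: "of_real (f N) * (Y (N+1) - Y N) = right_flux y + residual lam y N"
      using fN N by (simp add: Y_def)
    have "sl_op f q Y n = lam * of_real (w n) * Y n" if n: "n \<in> {1..N}" for n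
    proof -
      consider "n = 1" | "n = N" | "n \<in> {2..N-1}" using n by fastforce
      then show ?thesis
      proof cases
        case 1
        show ?thesis unfolding 1 sl_op_extend(2)[OF Yy] r1 ends by (simp add: residual_def)
      next
        case 2
        show ?thesis unfolding 2 sl_op_extend(3)[OF Yy] rN unfolding ends by (simp add: residual_def)
      next
        case 3
        show ?thesis using inner[OF 3] unfolding sl_op_extend(1)[OF Yy 3] bspec[OF Yy n]
          by (simp add: residual_def)
      qed
    qed
    moreover have "of_real (f N) * (Y (N+1) - Y N)
        = cis \<gamma> * (of_real (L$2$1) * Y 0 + of_real (L$2$2) * (of_real (f 0) * (Y 1 - Y 0)))"
    proof -
      have "cnj C * (cis \<gamma> * (of_real (L$2$1) * Y 0 + of_real (L$2$2) * (of_real (f 0) * (y 1 - Y 0)))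
          - right_flux y) = cnj C * residual lam y N"
        using boundary_balance[OF yN, of "Y 0"] balance unfolding r1
        by (simp add: add_eq_0_iff)
      moreover have "cnj C \<noteq> 0" using L11_nz by (simp add: C_def)
      ultimately have "cis \<gamma> * (of_real (L$2$1) * Y 0
          + of_real (L$2$2) * (of_real (f 0) * (y 1 - Y 0))) - right_flux y = residual lam y N"
        by (rule mult_left_cancel[THEN iffD1, rotated])
      then show ?thesis unfolding rN unfolding ends by (simp add: diff_eq_eq add.commute)
    qed
    moreover have "\<forall>n>N + 1. Y n = 0"
      using y by (auto simp: Y_def supported_def)
    ultimately have "sl_solution f q w N (cis_mat \<gamma> L) (- mat 1) lam Y"
      unfolding sl_solution_cis_mat_iff bc1 using yN ends by simp
    moreover have "trunc N Y = y"
      using y by (auto simp: trunc_def Y_def supported_def fun_eq_iff)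
    ultimately show "y \<in> trunc N ` sl_solution_space f q w N (cis_mat \<gamma> L) (- mat 1) lam"
      by (force simp: sl_solution_space_def)
  qed
qed

theorem singular_interlacing:
  "sl_has_exactly f q w N (cis_mat \<gamma> L) (- mat 1) (N - 1)"
  "n \<le> N - 2 \<Longrightarrow> sl_lambda f q w N (cis_mat \<gamma> K) (- mat 1) n \<le> sl_lambda f q w N (cis_mat \<gamma> L) (- mat 1) n
     \<and> sl_lambda f q w N (cis_mat \<gamma> L) (- mat 1) n \<le> sl_lambda f q w N (cis_mat \<gamma> K) (- mat 1) (n + 1)"
proof -
  obtain e \<mu> where e: "hermitian_pencil.eigenbasis cscale (supported N) (weighted N w) form N e \<mu>"
    using hermitian_pencil.eigenbasis_exists[OF pencil_supported] unfolding dim_supported by blast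
  obtain e' \<mu>' where
    e': "hermitian_pencil.eigenbasis cscale (hyperplane C) (weighted N w) form (N - 1) e' \<mu>'"
    using hermitian_pencil.eigenbasis_exists[OF pencil_hyperplane] unfolding dim_hyperplane by blast
  note spec = sl_spectrum_of_pencil[OF pencil_hyperplane e' linear_trunc
      trunc_inj_on_solutions[OF N f0 fN] trunc_singular_solutions sl_solution_subspace]
  show "sl_has_exactly f q w N (cis_mat \<gamma> L) (- mat 1) (N - 1)"
    by (rule spec)
  assume n: "n \<le> N - 2"
  have "\<mu> n \<le> \<mu>' n \<and> \<mu>' n \<le> \<mu> (Suc n)"
  proof (rule interlacing_hyperplane[OF pencil_supported pencil_hyperplane hyperplane_def _ _ _ e'])
    show "hermitian_pencil.eigenbasis cscale (supported N) (weighted N w) form (Suc (N - 1)) e \<mu>"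
      using e N by simp
  qed (use n N in \<open>simp_all add: algebra_simps\<close>)
  then show "sl_lambda f q w N (cis_mat \<gamma> K) (- mat 1) n \<le> sl_lambda f q w N (cis_mat \<gamma> L) (- mat 1) n
     \<and> sl_lambda f q w N (cis_mat \<gamma> L) (- mat 1) n \<le> sl_lambda f q w N (cis_mat \<gamma> K) (- mat 1) (n + 1)"
    using n N by (simp add: spec(2) regular_spectrum(2)[OF e])
qed

end

theorem theorem3p12:
  fixes f q w :: "nat \<Rightarrow> real" and N :: nat and \<gamma> :: real and K :: "real^2^2"
  assumes "N \<ge> 2"
    and "\<forall>n\<le>N. f n \<noteq> 0"
    and "\<forall>n\<in>{1..N}. w n > 0"
    and "-pi < \<gamma>" and "\<gamma> \<le> pi"
    and "det K = 1"
    and "K$1$1 - f 0 * K$1$2 \<noteq> 0"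
  shows "sl_has_exactly f q w N (cis_mat \<gamma> K) (- mat 1) N
    \<and> (K$1$1 \<noteq> 0 \<longrightarrow>
          sl_has_exactly f q w N (cis_mat \<gamma> (K_hat (f 0) K)) (- mat 1) (N - 1)
        \<and> (\<forall>n\<le>N-2.
             sl_lambda f q w N (cis_mat \<gamma> K) (- mat 1) n
               \<le> sl_lambda f q w N (cis_mat \<gamma> (K_hat (f 0) K)) (- mat 1) n
           \<and> sl_lambda f q w N (cis_mat \<gamma> (K_hat (f 0) K)) (- mat 1) n
               \<le> sl_lambda f q w N (cis_mat \<gamma> K) (- mat 1) (n+1)))
    \<and> (K$1$2 \<noteq> 0 \<longrightarrow>
          sl_has_exactly f q w N (cis_mat \<gamma> (K_tilde (f 0) K)) (- mat 1) (N - 1)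
        \<and> (\<forall>n\<le>N-2.
             sl_lambda f q w N (cis_mat \<gamma> K) (- mat 1) n
               \<le> sl_lambda f q w N (cis_mat \<gamma> (K_tilde (f 0) K)) (- mat 1) n
           \<and> sl_lambda f q w N (cis_mat \<gamma> (K_tilde (f 0) K)) (- mat 1) n
               \<le> sl_lambda f q w N (cis_mat \<gamma> K) (- mat 1) (n+1)))"
proof -
  have f0: "f 0 \<noteq> 0" using assms(2) by simp
  interpret regular_sl f q w N \<gamma> K
    by unfold_locales (use assms in \<open>auto simp: det_2\<close>)
  obtain e \<mu> where e: "hermitian_pencil.eigenbasis cscale (supported N) (weighted N w) form N e \<mu>"
    using hermitian_pencil.eigenbasis_exists[OF pencil_supported] unfolding dim_supported by blast
  \<comment> \<open>On this hyperplane \<open>K\<close> gives \<open>y 0 = y 1\<close>, a vanishing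
    initial difference; hence \<open>t = 1\<close>.\<close>
  have hat: "singular_sl f w N K (K_hat (f 0) K) 1" if "K$1$1 \<noteq> 0"
    by unfold_locales (use that f0 in \<open>simp_all add: K_hat_def mat22_def field_simps\<close>)
  \<comment> \<open>Here \<open>L11 = f 0 * k12\<close> cancels the numerator of
    \<open>left_val\<close>, so \<open>K\<close> gives \<open>y 0 = 0\<close>; hence
    \<open>t = 0\<close>.\<close>
  have tilde: "singular_sl f w N K (K_tilde (f 0) K) 0" if "K$1$2 \<noteq> 0"
    by unfold_locales (use that f0 in \<open>simp_all add: K_tilde_def mat22_def field_simps\<close>)
  show ?thesis
    using regular_spectrum(1)[OF e] singular_sl.singular_interlacing[OF hat]
      singular_sl.singular_interlacing[OF tilde] by blast
qed

end
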